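(* Let $G$ be a graph of order $n\geq 3$ such that $\overline{G}$ is bipartite and $e(\overline{G})=n-2$. Then $q(G)=3$ if and only if $\overline{G}$ is isomorphic to $S_{a,b}\cup K_1$ for some integers $a,b\geq 0$, and $q(G)=2$ otherwise.
   Context: All graphs are finite and simple; $\overline{G}$ denotes the complement of $G$ and $e(H)$ the number of edges of $H$. For a graph $G$ on $n$ vertices, $\mathcal{S}(G)$ is the set of real symmetric $n\times n$ matrices $A=[a_{ij}]$ with $a_{ij}\neq 0$ for $i\neq j$ if and only if $ij\in E(G)$ (diagonal unrestricted); $q(A)$ is the number of distinct eigenvalues of $A$ and $q(G)=\min\{q(A):A\in\mathcal{S}(G)\}$. For $a,b\geq 0$, $S_{a,b}$ is the tree with vertex set $\{x_1,\dots,x_a\}\cup\{u,v\}\cup\{y_1,\dots,y_b\}$ in which each $x_i$ is a leaf adjacent to $u$, each $y_j$ is a leaf adjacent to $v$, and $u$ is adjacent to $v$. $H\cup K_1$ denotes the disjoint union of $H$ with an isolated vertex. *)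

theory Defs
  imports "Jordan_Normal_Form.Spectral_Radius"
begin

section \<open>Simple graphs\<close>

record 'a sgraph =
  verts :: "'a set"
  edges :: "'a set set"

definition all_pairs :: "'a set \<Rightarrow> 'a set set" where
  "all_pairs V = {e. e \<subseteq> V \<and> card e = 2}"

definition simple_graph :: "'a sgraph \<Rightarrow> bool" where
  "simple_graph G \<longleftrightarrow> finite (verts G) \<and> edges G \<subseteq> all_pairs (verts G)"

definition graph_complement :: "'a sgraph \<Rightarrow> 'a sgraph" where
  "graph_complement G = \<lparr>verts = verts G, edges = all_pairs (verts G) - edges G\<rparr>"

text \<open>The two parts may be empty.\<close>

definition bipartite :: "'a sgraph \<Rightarrow> bool" where
  "bipartite G \<longleftrightarrow> (\<exists>X Y. X \<union> Y = verts G \<and> X \<inter> Y = {} \<and>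
     (\<forall>e\<in>edges G. \<exists>x\<in>X. \<exists>y\<in>Y. e = {x, y}))"

definition graph_isomorphic :: "'a sgraph \<Rightarrow> 'b sgraph \<Rightarrow> bool" where
  "graph_isomorphic G H \<longleftrightarrow> (\<exists>f. bij_betw f (verts G) (verts H) \<and>
     (\<forall>x\<in>verts G. \<forall>y\<in>verts G. {x, y} \<in> edges G \<longleftrightarrow> {f x, f y} \<in> edges H))"

definition disjoint_union :: "'a sgraph \<Rightarrow> 'b sgraph \<Rightarrow> ('a + 'b) sgraph" where
  "disjoint_union G H =
     \<lparr>verts = Inl ` verts G \<union> Inr ` verts H,
      edges = (\<lambda>e. Inl ` e) ` edges G \<union> (\<lambda>e. Inr ` e) ` edges H\<rparr>"

definition K1 :: "unit sgraph" where
  "K1 = \<lparr>verts = {()}, edges = {}\<rparr>"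

datatype ds_vertex = X nat | Y nat | U | V

definition double_star :: "nat \<Rightarrow> nat \<Rightarrow> ds_vertex sgraph" where
  "double_star a b =
     \<lparr>verts = X ` {1..a} \<union> {U, V} \<union> Y ` {1..b},
      edges = {{X i, U} |i. i \<in> {1..a}} \<union> {{U, V}} \<union> {{Y j, V} |j. j \<in> {1..b}}\<rparr>"

hide_const (open) X Y U V


section \<open>The parameter q\<close>

text \<open>
  A graph on n vertices has vertex set \<open>{..<n}\<close> here, so that its vertices index the rows and
  columns of a matrix in \<open>carrier_mat n n\<close>.  Real symmetric matrices have only real eigenvalues,
  so counting the real ones with \<^const>\<open>spectrum\<close> counts all of them.
\<close>

definition sym_matrices :: "nat sgraph \<Rightarrow> real mat set" where
  "sym_matrices G = {A. A \<in> carrier_mat (card (verts G)) (card (verts G)) \<and> transpose_mat A = A \<and>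
     (\<forall>i\<in>verts G. \<forall>j\<in>verts G. i \<noteq> j \<longrightarrow> (A $$ (i, j) \<noteq> 0 \<longleftrightarrow> {i, j} \<in> edges G))}"

definition q_mat :: "real mat \<Rightarrow> nat" where
  "q_mat A = card (spectrum A)"

definition q_graph :: "nat sgraph \<Rightarrow> nat" where
  "q_graph G = (INF A\<in>sym_matrices G. q_mat A)"

text \<open>The infimum is a minimum.\<close>

lemma sym_matrices_nonempty:
  assumes "verts G = {..<n}"
  shows "sym_matrices G \<noteq> {}"
proof -
  have "mat n n (\<lambda>(i, j). if {i, j} \<in> edges G then 1 else 0) \<in> sym_matrices G"
    using assms by (simp add: sym_matrices_def mat_eq_iff) (metis insert_commute)
  then show ?thesis by blast
qed

lemma q_graph_attained:
  assumes "verts G = {..<n}"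
  shows "\<exists>A\<in>sym_matrices G. q_mat A = q_graph G"
proof -
  have "q_graph G \<in> q_mat ` sym_matrices G"
    unfolding q_graph_def using sym_matrices_nonempty[OF assms] by (intro Inf_nat_def1) auto
  then show ?thesis by auto
qed

lemma q_graph_le: "A \<in> sym_matrices G \<Longrightarrow> q_graph G \<le> q_mat A"
  unfolding q_graph_def by (rule cINF_lower) auto

end

theory Submission
  imports Defs
begin

text \<open>
  Let \<open>H\<close> be the complement of \<open>G\<close>, with parts \<open>P\<close> and \<open>Q\<close>, so that \<open>P\<close> and \<open>Q\<close> are cliques of \<open>G\<close>,
  and let \<open>\<Gamma>\<close> be the bipartite graph of the edges of \<open>G\<close> between \<open>P\<close> and \<open>Q\<close>.

  If \<open>\<Gamma>\<close> is connected, then \<open>q(G) = 2\<close>: let \<open>M\<close> be a small multiple of the adjacency matrix of \<open>\<Gamma>\<close> and \<open>K\<close>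
  the diagonal matrix with entries 1 on \<open>P\<close> and -1 on \<open>Q\<close>. As \<open>K\<close> anticommutes with \<open>M\<close>, the matrix
  \<open>A = M + K sqrt (1 - M\<^sup>2)\<close> satisfies \<open>A\<^sup>2 = 1\<close>. It has the right zero pattern, because all coefficients
  of the power series \<open>1 - sqrt (1 - x)\<close> after the constant one are positive.

  If \<open>\<Gamma>\<close> is disconnected, counting the \<open>n - 2\<close> edges of \<open>H\<close> leaves two cases. If \<open>H\<close> has no isolated
  vertex, it is the disjoint union of two complete bipartite graphs, and \<open>A\<close> can be chosen as the Gram
  matrix of a tight frame in the plane. If \<open>H\<close> has an isolated vertex \<open>w\<close>, then \<open>w\<close> may be put on either
  side, and \<open>\<Gamma>\<close> is disconnected for both choices only if some vertex on each side is joined in \<open>H\<close> to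
  everything opposite except \<open>w\<close>, so that \<open>H\<close> is a double star and \<open>w\<close>.

  In that case the centres \<open>u\<close>, \<open>v\<close> are nonadjacent in \<open>G\<close> and \<open>w\<close> is their only common neighbour, so the
  entry \<open>(A\<^sup>2)\<^sub>u\<^sub>v = A\<^sub>u\<^sub>w A\<^sub>w\<^sub>v\<close> is nonzero, while \<open>A\<^sup>2\<close> would be a combination of \<open>A\<close> and 1 if \<open>A\<close> had only two
  eigenvalues. The Gram matrix of suitable vectors in three-space has three eigenvalues.
\<close>

section \<open>Spectra of real symmetric matrices\<close>

text \<open>The Hermitian form of \<open>A\<close> at an eigenvector equals \<open>c * s\<close>,
  where \<open>s\<close> is the squared norm, and it is its own conjugate. As \<open>s\<close> is
  real and nonzero, \<open>c\<close> is real, and a real root of the complex characteristic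
  polynomial is a root of the real one.\<close>

lemma real_symmetric_complex_eigenvalue_real:
  fixes A :: "real mat"
  assumes A: "A \<in> carrier_mat n n" and sym: "transpose_mat A = A"
    and ev: "eigenvalue (map_mat complex_of_real A) c"
  obtains r where "c = complex_of_real r" "r \<in> spectrum A"
proof -
  define D where "D = map_mat complex_of_real A"
  have D: "D \<in> carrier_mat n n" using A by (simp add: D_def)
  have AS: "A $$ (j, i) = A $$ (i, j)" if "i < n" "j < n" for i j
    using arg_cong[OF sym, of "\<lambda>B. B $$ (i, j)"] that A by auto
  from ev obtain v where v: "v \<in> carrier_vec n" "v \<noteq> 0\<^sub>v n" "D *\<^sub>v v = c \<cdot>\<^sub>v v"
    using A unfolding eigenvalue_def eigenvector_def D_def by auto
  define s where "s = (\<Sum>i<n. v $ i * cnj (v $ i))"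
  have s: "s = complex_of_real (\<Sum>i<n. (cmod (v $ i))\<^sup>2)"
    unfolding s_def of_real_sum by (intro sum.cong refl complex_norm_square[symmetric])
  have Dv: "(\<Sum>j<n. D $$ (i, j) * v $ j) = c * v $ i" if "i < n" for i
  proof -
    have "(D *\<^sub>v v) $ i = (c \<cdot>\<^sub>v v) $ i" using v by simp
    then show ?thesis using that D v(1) by (simp add: scalar_prod_def lessThan_atLeast0)
  qed
  have q: "(\<Sum>i<n. \<Sum>j<n. D $$ (i, j) * v $ j * cnj (v $ i)) = c * s"
  proof -
    have "(\<Sum>i<n. \<Sum>j<n. D $$ (i, j) * v $ j * cnj (v $ i)) = (\<Sum>i<n. c * v $ i * cnj (v $ i))"
      using Dv by (intro sum.cong refl) (simp add: sum_distrib_right[symmetric])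
    then show ?thesis by (simp add: s_def sum_distrib_left mult.assoc)
  qed
  have "cnj (c * s) = (\<Sum>i<n. \<Sum>j<n. D $$ (i, j) * cnj (v $ j) * v $ i)"
    unfolding q[symmetric] using A by (simp add: D_def)
  also have "\<dots> = (\<Sum>j<n. \<Sum>i<n. D $$ (i, j) * cnj (v $ j) * v $ i)"
    by (rule sum.swap)
  also have "\<dots> = c * s"
    unfolding q[symmetric] using A AS by (intro sum.cong refl) (simp add: D_def)
  finally have eq: "cnj (c * s) = c * s" .
  obtain i where i: "i < n" "v $ i \<noteq> 0" using v(1,2) by (metis eq_vecI carrier_vecD index_zero_vec)
  have "(\<Sum>i<n. (cmod (v $ i))\<^sup>2) > 0"
    using i by (intro sum_pos2[of _ i]) auto
  then have "s \<noteq> 0" "cnj s = s" unfolding s by (simp_all only: of_real_eq_0_iff complex_cnj_complex_of_real)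
  with eq have "cnj c = c" by simp
  then obtain r where r: "c = complex_of_real r" by (metis Reals_cases Reals_cnj_iff)
  have "poly (char_poly (map_mat complex_of_real A)) (complex_of_real r) = 0"
    using ev eigenvalue_root_char_poly[of D n c] D r unfolding D_def by simp
  then have "poly (char_poly A) r = 0"
    using of_real_hom.char_poly_hom[OF A, where ?'a = complex] by (simp add: of_real_hom.poly_map_poly)
  then have "r \<in> spectrum A" using eigenvalue_root_char_poly[OF A] by (simp add: spectrum_def)
  with r that show thesis by blast
qed

section \<open>Triangular matrices, traces and the quadratic relation for two eigenvalues\<close>

lemma upper_triangular_mult:
  fixes S T :: "'a::comm_ring_1 mat"
  assumes S: "S \<in> carrier_mat n n" "upper_triangular S" and T: "T \<in> carrier_mat n n" "upper_triangular T"
  shows "upper_triangular (S * T)"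
    and "i < n \<Longrightarrow> (S * T) $$ (i, i) = S $$ (i, i) * T $$ (i, i)"
proof -
  have e: "(S * T) $$ (i, j) = (if i = j then S $$ (i, i) * T $$ (i, i) else 0)" if "i < n" "j \<le> i" for i j
  proof -
    have "(S * T) $$ (i, j) = (\<Sum>k<n. S $$ (i, k) * T $$ (k, j))"
      using S(1) T(1) that by (simp add: scalar_prod_def lessThan_atLeast0)
    also have "\<dots> = (\<Sum>k<n. if k = i then S $$ (i, i) * T $$ (i, j) else 0)"
    proof (intro sum.cong refl)
      fix k assume "k \<in> {..<n}"
      then show "S $$ (i, k) * T $$ (k, j) = (if k = i then S $$ (i, i) * T $$ (i, j) else 0)"
        using upper_triangularD[OF S(2), of k i] upper_triangularD[OF T(2), of j k] S(1) T(1) that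
        by (cases k i rule: linorder_cases) auto
    qed
    also have "\<dots> = S $$ (i, i) * T $$ (i, j)" using that by simp
    finally show ?thesis
      using upper_triangularD[OF T(2), of j i] T(1) that by (cases "i = j") auto
  qed
  show "upper_triangular (S * T)"
    unfolding upper_triangular_def using e S(1) by auto
  show "(S * T) $$ (i, i) = S $$ (i, i) * T $$ (i, i)" if "i < n"
    using e[OF that] by simp
qed

lemma trace_mult_commute:
  fixes S T :: "'a::comm_ring_1 mat"
  assumes "S \<in> carrier_mat n n" "T \<in> carrier_mat n n"
  shows "(\<Sum>i<n. (S * T) $$ (i, i)) = (\<Sum>i<n. (T * S) $$ (i, i))"
proof -
  have "(\<Sum>i<n. (S * T) $$ (i, i)) = (\<Sum>i<n. \<Sum>j<n. S $$ (i, j) * T $$ (j, i))"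
    using assms by (simp add: scalar_prod_def lessThan_atLeast0)
  also have "\<dots> = (\<Sum>j<n. \<Sum>i<n. S $$ (i, j) * T $$ (j, i))" by (rule sum.swap)
  also have "\<dots> = (\<Sum>i<n. (T * S) $$ (i, i))"
    using assms by (simp add: scalar_prod_def lessThan_atLeast0 mult.commute)
  finally show ?thesis .
qed

text \<open>The trace of the square of a real symmetric matrix is the sum of the squares of all its
  entries.\<close>

lemma real_symmetric_square_trace_eq_0:
  fixes C :: "real mat"
  assumes C: "C \<in> carrier_mat n n" and sym: "transpose_mat C = C"
    and tr: "(\<Sum>i<n. (C * C) $$ (i, i)) = 0"
  shows "C = 0\<^sub>m n n"
proof -
  have CS: "C $$ (j, i) = C $$ (i, j)" if "i < n" "j < n" for i j
    using arg_cong[OF sym, of "\<lambda>B. B $$ (i, j)"] that C by auto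
  have "(\<Sum>i<n. \<Sum>j<n. (C $$ (i, j))\<^sup>2) = 0"
    using tr C CS by (simp add: scalar_prod_def lessThan_atLeast0 power2_eq_square)
  then have "\<forall>i<n. \<forall>j<n. C $$ (i, j) = 0"
    by (simp add: sum_nonneg_eq_0_iff sum_nonneg)
  then show ?thesis using C by (intro eq_matI) auto
qed

lemma mult_shifted_mat:
  fixes A :: "'a::comm_ring_1 mat"
  assumes A: "A \<in> carrier_mat n n"
  shows "(A - x \<cdot>\<^sub>m 1\<^sub>m n) * (A - y \<cdot>\<^sub>m 1\<^sub>m n) = A * A - (x + y) \<cdot>\<^sub>m A + (x * y) \<cdot>\<^sub>m 1\<^sub>m n"
proof -
  have "(A - x \<cdot>\<^sub>m 1\<^sub>m n) * (A - y \<cdot>\<^sub>m 1\<^sub>m n) =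
      A * (A - y \<cdot>\<^sub>m 1\<^sub>m n) - (x \<cdot>\<^sub>m 1\<^sub>m n) * (A - y \<cdot>\<^sub>m 1\<^sub>m n)"
    using A by (intro minus_mult_distrib_mat[of _ n n _ _ n] minus_carrier_mat) auto
  also have "A * (A - y \<cdot>\<^sub>m 1\<^sub>m n) = A * A - A * (y \<cdot>\<^sub>m 1\<^sub>m n)"
    using A by (intro mult_minus_distrib_mat[of _ n n _ n]) auto
  also have "A * (y \<cdot>\<^sub>m 1\<^sub>m n) = y \<cdot>\<^sub>m A"
    using A by (simp add: mult_smult_distrib[of _ n n _ n])
  also have "(x \<cdot>\<^sub>m 1\<^sub>m n) * (A - y \<cdot>\<^sub>m 1\<^sub>m n) = x \<cdot>\<^sub>m (A - y \<cdot>\<^sub>m 1\<^sub>m n)"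
    using A by (simp add: mult_smult_assoc_mat[of _ n n _ n] minus_carrier_mat)
  finally have "(A - x \<cdot>\<^sub>m 1\<^sub>m n) * (A - y \<cdot>\<^sub>m 1\<^sub>m n) =
      A * A - y \<cdot>\<^sub>m A - x \<cdot>\<^sub>m (A - y \<cdot>\<^sub>m 1\<^sub>m n)" .
  then show ?thesis using A by (intro eq_matI) (auto simp: algebra_simps)
qed

text \<open>A complex Schur form \<open>P * B * Q\<close> takes the place of a diagonalisation. The
  product \<open>T\<close> of the shifts of \<open>B\<close> is triangular with zero diagonal, so
  \<open>C * C\<close>, which is similar to \<open>T * T\<close> over the complex numbers, has trace
  0. The two factors of \<open>C\<close> commute, hence \<open>C\<close> is symmetric and the trace
  forces \<open>C = 0\<close>.\<close>

lemma real_symmetric_annihilated: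
  fixes A :: "real mat"
  assumes A: "A \<in> carrier_mat n n" and sym: "transpose_mat A = A"
    and sp: "spectrum A \<subseteq> {a, b}"
  shows "(A - a \<cdot>\<^sub>m 1\<^sub>m n) * (A - b \<cdot>\<^sub>m 1\<^sub>m n) = 0\<^sub>m n n"
proof -
  define C where "C = (A - a \<cdot>\<^sub>m 1\<^sub>m n) * (A - b \<cdot>\<^sub>m 1\<^sub>m n)"
  define c where "c = complex_of_real"
  define D where "D = map_mat c A"
  have C: "C \<in> carrier_mat n n"
    unfolding C_def by (intro mult_carrier_mat[of _ n n] minus_carrier_mat) auto
  have D: "D \<in> carrier_mat n n" using A by (simp add: D_def)
  obtain es where es: "char_poly D = (\<Prod>e\<leftarrow>es. [:- e, 1:])"
    using char_poly_factorized[OF D] by auto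
  obtain B P Q where BPQ: "schur_decomposition D es = (B, P, Q)" by (cases "schur_decomposition D es") auto
  note sd = schur_decomposition[OF D es BPQ]
  have car: "B \<in> carrier_mat n n" "P \<in> carrier_mat n n" "Q \<in> carrier_mat n n"
    and PQ: "P * Q = 1\<^sub>m n" "Q * P = 1\<^sub>m n" and DB: "D = P * B * Q"
    and ut: "upper_triangular B" and diag: "diag_mat B = es"
    using sd D unfolding similar_mat_wit_def Let_def by auto
  have B_diag: "B $$ (i, i) = c a \<or> B $$ (i, i) = c b" if "i < n" for i
  proof -
    have "B $$ (i, i) \<in> set es" using that car(1) diag[symmetric] by (simp add: diag_mat_def)
    then have "poly (char_poly D) (B $$ (i, i)) = 0"
      unfolding es by (induction es) auto
    then have "eigenvalue D (B $$ (i, i))" using eigenvalue_root_char_poly[OF D] by simp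
    then show ?thesis
      using real_symmetric_complex_eigenvalue_real[OF A sym] sp unfolding D_def c_def by blast
  qed
  define Bs where "Bs = (\<lambda>x. B - c x \<cdot>\<^sub>m 1\<^sub>m n)"
  have Bs: "Bs x \<in> carrier_mat n n" "upper_triangular (Bs x)" for x
    using car(1) ut by (auto simp: Bs_def upper_triangular_def)
  have shift: "map_mat c (A - x \<cdot>\<^sub>m 1\<^sub>m n) = P * Bs x * Q" for x
  proof -
    have "P * Bs x * Q = P * B * Q - P * (c x \<cdot>\<^sub>m 1\<^sub>m n) * Q"
      using car by (simp add: Bs_def mult_minus_distrib_mat[of _ n n _ n] minus_mult_distrib_mat[of _ n n _ _ n])
    also have "P * (c x \<cdot>\<^sub>m 1\<^sub>m n) * Q = c x \<cdot>\<^sub>m (P * Q)"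
      using car by (simp add: mult_smult_distrib[of _ n n _ n] mult_smult_assoc_mat[of _ n n _ n])
    finally have "P * Bs x * Q = D - c x \<cdot>\<^sub>m 1\<^sub>m n" by (simp add: PQ DB)
    also have "\<dots> = map_mat c (A - x \<cdot>\<^sub>m 1\<^sub>m n)"
      using A by (intro eq_matI) (auto simp: D_def c_def)
    finally show ?thesis by simp
  qed
  have conj: "(P * S * Q) * (P * T * Q) = P * (S * T) * Q"
    if "S \<in> carrier_mat n n" "T \<in> carrier_mat n n" for S T
  proof -
    have "(P * S * Q) * (P * T * Q) = P * S * (Q * P) * T * Q"
      using that car by (simp add: assoc_mult_mat[of _ n n _ n _ n])
    also have "\<dots> = P * (S * T) * Q"
      using that car by (simp add: PQ assoc_mult_mat[of _ n n _ n _ n])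
    finally show ?thesis .
  qed
  \<comment> \<open>The diagonal of \<open>B\<close> consists of eigenvalues, so \<open>T\<close> is strictly upper triangular.\<close>
  define T where "T = Bs a * Bs b"
  have T: "T \<in> carrier_mat n n" "upper_triangular T"
    unfolding T_def using Bs by (auto intro: upper_triangular_mult(1) mult_carrier_mat)
  have T_diag: "T $$ (i, i) = 0" if "i < n" for i
    using upper_triangular_mult(2)[OF Bs Bs that, of a b] B_diag[OF that] that car(1)
    by (auto simp: T_def Bs_def)
  have hom: "map_mat c (S * R) = map_mat c S * map_mat c R"
    if "S \<in> carrier_mat n n" "R \<in> carrier_mat n n" for S R
    unfolding c_def by (rule of_real_hom.mat_hom_mult[OF that])
  have CT: "map_mat c C = P * T * Q"
    using A Bs by (simp add: C_def hom shift conj T_def minus_carrier_mat)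
  have "c (\<Sum>i<n. (C * C) $$ (i, i)) = (\<Sum>i<n. map_mat c (C * C) $$ (i, i))"
    using C by (simp add: c_def)
  also have "\<dots> = (\<Sum>i<n. (P * (T * T) * Q) $$ (i, i))"
    unfolding hom[OF C C] CT conj[OF T(1) T(1)] ..
  also have "\<dots> = (\<Sum>i<n. (Q * (P * (T * T))) $$ (i, i))"
    using T car by (intro trace_mult_commute) auto
  also have "Q * (P * (T * T)) = T * T"
    using T assoc_mult_mat[OF car(3,2), of "T * T" n] by (simp add: PQ)
  also have "(\<Sum>i<n. (T * T) $$ (i, i)) = 0"
    using upper_triangular_mult(2)[OF T T] T_diag by simp
  finally have tr: "(\<Sum>i<n. (C * C) $$ (i, i)) = 0"
    by (simp only: c_def of_real_eq_0_iff)
  have "transpose_mat C = (A - b \<cdot>\<^sub>m 1\<^sub>m n) * (A - a \<cdot>\<^sub>m 1\<^sub>m n)"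
  proof -
    have "transpose_mat (A - x \<cdot>\<^sub>m 1\<^sub>m n) = A - x \<cdot>\<^sub>m 1\<^sub>m n" for x
    proof -
      have "A $$ (j, i) = A $$ (i, j)" if "i < n" "j < n" for i j
        using arg_cong[OF sym, of "\<lambda>B. B $$ (i, j)"] that A by auto
      then show ?thesis using A by (intro eq_matI) auto
    qed
    then show ?thesis using A by (simp add: C_def transpose_mult[of _ n n _ n] minus_carrier_mat)
  qed
  also have "\<dots> = C"
  proof -
    show ?thesis
      by (simp add: C_def mult_shifted_mat[OF A] add.commute[of b a] mult.commute[of b a])
  qed
  finally have "transpose_mat C = C" .
  from real_symmetric_square_trace_eq_0[OF C this tr] show ?thesis by (simp add: C_def)
qed

text \<open>The vanishing product of shifts, expanded: \<open>A * A\<close> is a combination of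
  \<open>A\<close> and the identity. Both lower bounds on q rest on this form.\<close>

lemma real_symmetric_two_eigenvalues:
  fixes A :: "real mat"
  assumes A: "A \<in> carrier_mat n n" and sym: "transpose_mat A = A"
    and sp: "spectrum A \<subseteq> {a, b}" and ij: "i < n" "j < n"
  shows "(\<Sum>l<n. A $$ (i, l) * A $$ (l, j)) = (a + b) * A $$ (i, j) - (if i = j then a * b else 0)"
proof -
  have "(A * A - (a + b) \<cdot>\<^sub>m A + (a * b) \<cdot>\<^sub>m 1\<^sub>m n) $$ (i, j) = 0"
    using real_symmetric_annihilated[OF A sym sp] ij by (simp add: mult_shifted_mat[OF A])
  then show ?thesis
    using A ij by (simp add: scalar_prod_def lessThan_atLeast0 split: if_splits)
qed

text \<open>For \<open>a = b\<close> the diagonal entry at \<open>i\<close> of the quadratic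
  relation says that the square of \<open>A $$ (i, i) - a\<close> and the squares of the other
  entries of row \<open>i\<close> add up to 0.\<close>

lemma real_symmetric_one_eigenvalue:
  fixes A :: "real mat"
  assumes A: "A \<in> carrier_mat n n" and sym: "transpose_mat A = A"
    and sp: "spectrum A \<subseteq> {a}" and ij: "i < n" "j < n" "i \<noteq> j"
  shows "A $$ (i, j) = 0"
proof -
  have AS: "A $$ (l, i) = A $$ (i, l)" if "l < n" for l
    using arg_cong[OF sym, of "\<lambda>B. B $$ (i, l)"] that ij A by auto
  have "(\<Sum>l\<in>{i, j}. (A $$ (i, l))\<^sup>2) \<le> (\<Sum>l<n. (A $$ (i, l))\<^sup>2)"
    using ij by (intro sum_mono2) auto
  also have "\<dots> = (\<Sum>l<n. A $$ (i, l) * A $$ (l, i))"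
    using AS by (intro sum.cong refl) (simp add: power2_eq_square)
  also have "\<dots> = 2 * a * A $$ (i, i) - a * a"
    using real_symmetric_two_eigenvalues[OF A sym, of a a i i] sp ij by simp
  finally have "(A $$ (i, i) - a)\<^sup>2 + (A $$ (i, j))\<^sup>2 \<le> 0"
    using ij(3) by (simp add: power2_eq_square algebra_simps)
  then have "(A $$ (i, j))\<^sup>2 \<le> 0"
    using zero_le_power2[of "A $$ (i, i) - a"] by linarith
  then show ?thesis by simp
qed

section \<open>Spectra of involutions and of Gram matrices\<close>

lemma spectrum_involution:
  fixes A :: "real mat"
  assumes A: "A \<in> carrier_mat n n" and "A * A = 1\<^sub>m n"
  shows "spectrum A \<subseteq> {1, - 1}"
proof
  fix k assume "k \<in> spectrum A"
  then obtain v where v: "v \<in> carrier_vec n" "v \<noteq> 0\<^sub>v n" "A *\<^sub>v v = k \<cdot>\<^sub>v v"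
    using A unfolding spectrum_def eigenvalue_def eigenvector_def by auto
  have "v = (A * A) *\<^sub>v v" using assms(2) v(1) by simp
  also have "\<dots> = A *\<^sub>v (k \<cdot>\<^sub>v v)" using A v by (simp add: assoc_mult_mat_vec[of _ n n _ n])
  also have "\<dots> = k \<cdot>\<^sub>v (k \<cdot>\<^sub>v v)" using A v by (simp add: mult_mat_vec[of _ n n])
  finally have eq: "v = k \<cdot>\<^sub>v (k \<cdot>\<^sub>v v)" .
  obtain i where i: "i < n" "v $ i \<noteq> 0" using v(1,2) by (metis eq_vecI carrier_vecD index_zero_vec)
  have "v $ i = k * (k * v $ i)" using arg_cong[OF eq, of "\<lambda>u. u $ i"] v(1) i by simp
  then have "k * k = 1" using i by simp
  then show "k \<in> {1, - 1}" by (auto simp: square_eq_1_iff)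
qed

text \<open>Nonzero eigenvalues of the Gram matrix are those of the 3 by 3 matrix of inner products
  of \<open>f\<close>, \<open>g\<close>, \<open>h\<close>. This consists of the block with diagonal
  \<alpha> and off-diagonal \<delta>, and the single entry \<gamma>.\<close>

lemma spectrum_gram:
  fixes f g h :: "nat \<Rightarrow> real"
  assumes ff: "(\<Sum>i<n. f i * f i) = \<alpha>" and gg: "(\<Sum>i<n. g i * g i) = \<alpha>" and fg: "(\<Sum>i<n. f i * g i) = \<delta>"
    and fh: "(\<Sum>i<n. f i * h i) = 0" and gh: "(\<Sum>i<n. g i * h i) = 0" and hh: "(\<Sum>i<n. h i * h i) = \<gamma>"
  shows "spectrum (mat n n (\<lambda>(i, j). f i * f j + g i * g j + h i * h j)) \<subseteq> {0, \<alpha> + \<delta>, \<alpha> - \<delta>, \<gamma>}"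
proof
  define A where "A = mat n n (\<lambda>(i, j). f i * f j + g i * g j + h i * h j)"
  fix k assume "k \<in> spectrum (mat n n (\<lambda>(i, j). f i * f j + g i * g j + h i * h j))"
  then obtain v where v: "v \<in> carrier_vec n" "v \<noteq> 0\<^sub>v n" "A *\<^sub>v v = k \<cdot>\<^sub>v v"
    unfolding spectrum_def eigenvalue_def eigenvector_def A_def by auto
  define ip where "ip = (\<lambda>f. \<Sum>i<n. f i * v $ i)"
  have kv: "k * v $ i = f i * ip f + g i * ip g + h i * ip h" if "i < n" for i
  proof -
    have "k * v $ i = (A *\<^sub>v v) $ i" using v that by simp
    also have "\<dots> = (\<Sum>j<n. (f i * f j + g i * g j + h i * h j) * v $ j)"
      using v(1) that by (simp add: A_def scalar_prod_def lessThan_atLeast0)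
    also have "\<dots> = f i * ip f + g i * ip g + h i * ip h"
      by (simp add: ip_def sum_distrib_left sum.distrib distrib_right mult.assoc)
    finally show ?thesis .
  qed
  have kip: "k * ip e = (\<Sum>i<n. e i * f i) * ip f + (\<Sum>i<n. e i * g i) * ip g + (\<Sum>i<n. e i * h i) * ip h" for e
  proof -
    have "k * ip e = (\<Sum>i<n. e i * (k * v $ i))" by (simp add: ip_def sum_distrib_left mult_ac)
    also have "\<dots> = (\<Sum>i<n. e i * (f i * ip f + g i * ip g + h i * ip h))"
      using kv by (intro sum.cong) auto
    finally show ?thesis by (simp add: sum_distrib_right sum.distrib distrib_left mult.assoc)
  qed
  have f: "k * ip f = \<alpha> * ip f + \<delta> * ip g" and g: "k * ip g = \<delta> * ip f + \<alpha> * ip g" and h: "k * ip h = \<gamma> * ip h"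
    using kip[of f] kip[of g] kip[of h] ff gg fg fh gh hh
    by (simp_all add: mult.commute[of "g _" "f _"] mult.commute[of "h _" "f _"] mult.commute[of "h _" "g _"])
  show "k \<in> {0, \<alpha> + \<delta>, \<alpha> - \<delta>, \<gamma>}"
  proof (rule ccontr)
    assume k: "k \<notin> {0, \<alpha> + \<delta>, \<alpha> - \<delta>, \<gamma>}"
    \<comment> \<open>The block has the eigenvectors (1, 1) and (1, -1), so sum and difference
      decouple the two equations.\<close>
    have "(k - (\<alpha> + \<delta>)) * (ip f + ip g) = 0" "(k - (\<alpha> - \<delta>)) * (ip f - ip g) = 0"
      using f g by (simp_all add: algebra_simps)
    then have "ip f = 0" "ip g = 0" "ip h = 0" using k h by auto
    then have "v $ i = 0" if "i < n" for i using kv[OF that] k by simp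
    then show False using v(1,2) by (metis eq_vecI carrier_vecD index_zero_vec)
  qed
qed

section \<open>Square roots of nonnegative matrices and involutions\<close>

text \<open>
  The iterates of \<open>Z \<mapsto> (N + Z\<^sup>2) / 2\<close> started at 0 increase entrywise, with row sums at most 1, so
  \<open>1 - sqrt (1 - N)\<close> is their limit, without power series of matrices.
\<close>

primrec sqrt_iterate :: "real mat \<Rightarrow> nat \<Rightarrow> real mat" where
  "sqrt_iterate N 0 = 0\<^sub>m (dim_row N) (dim_row N)"
| "sqrt_iterate N (Suc k) = (1 / 2) \<cdot>\<^sub>m (N + sqrt_iterate N k * sqrt_iterate N k)"

lemma index_mult_mat_sum:
  assumes "S \<in> carrier_mat n n" "T \<in> carrier_mat n n" "i < n" "j < n"
  shows "(S * T) $$ (i, j) = (\<Sum>l<n. S $$ (i, l) * T $$ (l, j))"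
  using assms by (simp add: scalar_prod_def lessThan_atLeast0)

lemma sqrt_iterate_carrier:
  assumes "N \<in> carrier_mat n n"
  shows "sqrt_iterate N k \<in> carrier_mat n n"
  using assms by (induction k) auto

lemma index_sqrt_iterate_Suc:
  assumes "N \<in> carrier_mat n n" "i < n" "j < n"
  shows "sqrt_iterate N (Suc k) $$ (i, j) =
    (N $$ (i, j) + (\<Sum>l<n. sqrt_iterate N k $$ (i, l) * sqrt_iterate N k $$ (l, j))) / 2"
  using assms sqrt_iterate_carrier[OF assms(1), of k]
    index_mult_mat_sum[of "sqrt_iterate N k" n "sqrt_iterate N k" i j] by (simp add: field_simps)

text \<open>Every iterate is a polynomial in \<open>N\<close>.\<close>

lemma sqrt_iterate_commute:
  assumes N: "N \<in> carrier_mat n n" and C: "C \<in> carrier_mat n n" and "C * N = N * C"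
  shows "C * sqrt_iterate N k = sqrt_iterate N k * C"
proof (induction k)
  case 0
  then show ?case using N C by simp
next
  case (Suc k)
  define Z where "Z = sqrt_iterate N k"
  have Z: "Z \<in> carrier_mat n n" unfolding Z_def by (rule sqrt_iterate_carrier[OF N])
  have IH: "C * Z = Z * C" using Suc by (simp add: Z_def)
  have "C * (Z * Z) = (C * Z) * Z" using C Z by (simp add: assoc_mult_mat[of _ n n _ n _ n])
  also have "\<dots> = Z * (C * Z)" using C Z by (simp add: IH assoc_mult_mat[of _ n n _ n _ n])
  also have "\<dots> = (Z * Z) * C" using C Z by (simp add: IH assoc_mult_mat[of _ n n _ n _ n])
  finally have "C * (Z * Z) = (Z * Z) * C" .
  then show ?case
    using C Z N assms(3)
    by (simp add: Z_def[symmetric] mult_smult_distrib[of _ n n _ n] mult_smult_assoc_mat[of _ n n _ n]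
        mult_add_distrib_mat[of _ n n _ n] add_mult_distrib_mat[of _ n n _ _ n])
qed

lemma sqrt_iterate_symmetric:
  assumes N: "N \<in> carrier_mat n n" and "transpose_mat N = N"
  shows "transpose_mat (sqrt_iterate N k) = sqrt_iterate N k"
proof (induction k)
  case 0
  then show ?case using N by simp
next
  case (Suc k)
  note Z = sqrt_iterate_carrier[OF N, of k]
  have "transpose_mat (x \<cdot>\<^sub>m S) = x \<cdot>\<^sub>m transpose_mat S" for x :: real and S
    by (rule eq_matI) auto
  then show ?case
    using N Z assms(2) Suc by (simp add: transpose_add[of _ n n] transpose_mult[of _ n n _ n])
qed

text \<open>One induction serves all three bounds: monotonicity and the row bound multiply
  nonnegative entries, and monotonicity keeps the next iterate nonnegative. Row sums at most 1
  survive squaring and averaging with \<open>N\<close>.\<close>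

lemma sqrt_iterate_bounds:
  assumes N: "N \<in> carrier_mat n n"
    and nonneg: "\<And>i j. i < n \<Longrightarrow> j < n \<Longrightarrow> N $$ (i, j) \<ge> 0"
    and rows: "\<And>i. i < n \<Longrightarrow> (\<Sum>j<n. N $$ (i, j)) \<le> 1"
  shows "(\<forall>i<n. \<forall>j<n. 0 \<le> sqrt_iterate N k $$ (i, j) \<and>
            sqrt_iterate N k $$ (i, j) \<le> sqrt_iterate N (Suc k) $$ (i, j)) \<and>
         (\<forall>i<n. (\<Sum>j<n. sqrt_iterate N k $$ (i, j)) \<le> 1)"
proof (induction k)
  case 0
  show ?case using N nonneg by (auto simp: index_sqrt_iterate_Suc[OF N] simp del: sqrt_iterate.simps(2))
next
  case (Suc k)
  define Z where "Z = (\<lambda>k i j. sqrt_iterate N k $$ (i, j))"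
  have step: "Z (Suc k) i j = (N $$ (i, j) + (\<Sum>l<n. Z k i l * Z k l j)) / 2" if "i < n" "j < n" for i j k
    unfolding Z_def by (rule index_sqrt_iterate_Suc[OF N that])
  have IH: "0 \<le> Z k i j" "Z k i j \<le> Z (Suc k) i j" "(\<Sum>j<n. Z k i j) \<le> 1" if "i < n" "j < n" for i j
    using Suc that unfolding Z_def by blast+
  have nonneg': "0 \<le> Z (Suc k) i j" if "i < n" "j < n" for i j
    using IH[OF that] by linarith
  have le: "Z (Suc k) i j \<le> Z (Suc (Suc k)) i j" if "i < n" "j < n" for i j
    unfolding step[OF that, of k] step[OF that, of "Suc k"]
    using IH nonneg' that by (intro divide_right_mono add_left_mono sum_mono mult_mono) auto
  have row: "(\<Sum>j<n. Z (Suc k) i j) \<le> 1" if i: "i < n" for i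
  proof -
    have "(\<Sum>j<n. \<Sum>l<n. Z k i l * Z k l j) = (\<Sum>l<n. Z k i l * (\<Sum>j<n. Z k l j))"
      by (subst sum.swap) (simp add: sum_distrib_left)
    also have "\<dots> \<le> (\<Sum>l<n. Z k i l * 1)"
      using IH i by (intro sum_mono mult_left_mono) auto
    also have "\<dots> \<le> 1" using IH i by simp
    finally have "(\<Sum>j<n. N $$ (i, j)) + (\<Sum>j<n. \<Sum>l<n. Z k i l * Z k l j) \<le> 1 + 1"
      using rows[OF i] by linarith
    moreover have "(\<Sum>j<n. Z (Suc k) i j) =
        ((\<Sum>j<n. N $$ (i, j)) + (\<Sum>j<n. \<Sum>l<n. Z k i l * Z k l j)) / 2"
      using i by (simp add: step sum.distrib sum_divide_distrib[symmetric])
    ultimately show ?thesis by simp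
  qed
  from nonneg' le row show ?case unfolding Z_def by blast
qed

text \<open>The equation \<open>2 \<cdot>\<^sub>m Z = N + Z * Z\<close> says that
  \<open>1 - Z\<close> is a square root of \<open>1 - N\<close>. The entries of the iterates
  increase and are bounded by their row sums, so they converge, and every property passes to the
  limit entrywise.\<close>

lemma nonneg_sqrt_complement:
  fixes N :: "real mat"
  assumes N: "N \<in> carrier_mat n n"
    and sym: "transpose_mat N = N"
    and nonneg: "\<And>i j. i < n \<Longrightarrow> j < n \<Longrightarrow> N $$ (i, j) \<ge> 0"
    and rows: "\<And>i. i < n \<Longrightarrow> (\<Sum>j<n. N $$ (i, j)) \<le> 1"
  obtains Z where "Z \<in> carrier_mat n n" "transpose_mat Z = Z"
    "\<And>i j. i < n \<Longrightarrow> j < n \<Longrightarrow> Z $$ (i, j) \<ge> 0"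
    "2 \<cdot>\<^sub>m Z = N + Z * Z"
    "\<And>C. C \<in> carrier_mat n n \<Longrightarrow> C * N = N * C \<Longrightarrow> C * Z = Z * C"
proof -
  define z where "z = (\<lambda>i j. lim (\<lambda>k. sqrt_iterate N k $$ (i, j)))"
  define Z where "Z = mat n n (\<lambda>(i, j). z i j)"
  have Z: "Z \<in> carrier_mat n n" by (simp add: Z_def)
  note it = sqrt_iterate_carrier[OF N]
  note bounds = sqrt_iterate_bounds[OF N nonneg rows]
  have lim: "(\<lambda>k. sqrt_iterate N k $$ (i, j)) \<longlonglongrightarrow> Z $$ (i, j)" if ij: "i < n" "j < n" for i j
  proof -
    have "incseq (\<lambda>k. sqrt_iterate N k $$ (i, j))"
      using bounds ij by (intro incseq_SucI) blast
    moreover have "sqrt_iterate N k $$ (i, j) \<le> 1" for k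
    proof -
      have "sqrt_iterate N k $$ (i, j) \<le> (\<Sum>j<n. sqrt_iterate N k $$ (i, j))"
        using bounds ij by (intro member_le_sum) auto
      then show ?thesis using bounds ij(1) order_trans by blast
    qed
    ultimately have "convergent (\<lambda>k. sqrt_iterate N k $$ (i, j))"
      by (intro Bseq_mono_convergent) (use bounds ij in \<open>auto simp: incseq_def monoseq_def abs_le_iff intro!: BseqI'[where K = 1] intro: order_trans[of _ 0]\<close>)
    then show ?thesis using ij by (simp add: Z_def z_def convergent_LIMSEQ_iff)
  qed
  show thesis
  proof
    show "Z \<in> carrier_mat n n" by (rule Z)
    show "Z $$ (i, j) \<ge> 0" if "i < n" "j < n" for i j
      using LIMSEQ_le_const[OF lim[OF that]] bounds that by blast
    show "transpose_mat Z = Z"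
    proof (rule eq_matI)
      fix i j assume "i < dim_row Z" "j < dim_col Z"
      then have ij: "i < n" "j < n" using Z by auto
      have "sqrt_iterate N k $$ (j, i) = sqrt_iterate N k $$ (i, j)" for k
        using arg_cong[OF sqrt_iterate_symmetric[OF N sym, of k], of "\<lambda>B. B $$ (i, j)"] it[of k] ij by auto
      then have "Z $$ (j, i) = Z $$ (i, j)"
        using lim[OF ij] lim[OF ij(2,1)] LIMSEQ_unique by auto
      then show "transpose_mat Z $$ (i, j) = Z $$ (i, j)" using Z ij by simp
    qed (use Z in auto)
    show "2 \<cdot>\<^sub>m Z = N + Z * Z"
    proof (rule eq_matI)
      fix i j assume "i < dim_row (N + Z * Z)" "j < dim_col (N + Z * Z)"
      then have ij: "i < n" "j < n" using Z by auto
      have "(\<lambda>k. sqrt_iterate N (Suc k) $$ (i, j)) \<longlonglongrightarrow> (N $$ (i, j) + (\<Sum>l<n. Z $$ (i, l) * Z $$ (l, j))) / 2"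
        unfolding index_sqrt_iterate_Suc[OF N ij] using ij by (intro tendsto_intros lim) auto
      moreover have "(\<lambda>k. sqrt_iterate N (Suc k) $$ (i, j)) \<longlonglongrightarrow> Z $$ (i, j)"
        by (rule LIMSEQ_Suc[OF lim[OF ij]])
      ultimately have "Z $$ (i, j) = (N $$ (i, j) + (\<Sum>l<n. Z $$ (i, l) * Z $$ (l, j))) / 2"
        by (rule LIMSEQ_unique[symmetric])
      then show "(2 \<cdot>\<^sub>m Z) $$ (i, j) = (N + Z * Z) $$ (i, j)"
        using N Z ij by (simp add: index_mult_mat_sum[OF Z Z] del: index_mult_mat(1))
    qed (use N Z in auto)
    show "C * Z = Z * C" if C: "C \<in> carrier_mat n n" "C * N = N * C" for C
    proof (rule eq_matI)
      fix i j assume "i < dim_row (Z * C)" "j < dim_col (Z * C)"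
      then have ij: "i < n" "j < n" using Z C by auto
      have "(\<lambda>k. \<Sum>l<n. C $$ (i, l) * sqrt_iterate N k $$ (l, j)) \<longlonglongrightarrow> (\<Sum>l<n. C $$ (i, l) * Z $$ (l, j))"
        using ij by (intro tendsto_intros lim) auto
      moreover have "(\<lambda>k. \<Sum>l<n. sqrt_iterate N k $$ (i, l) * C $$ (l, j)) \<longlonglongrightarrow> (\<Sum>l<n. Z $$ (i, l) * C $$ (l, j))"
        using ij by (intro tendsto_intros lim) auto
      moreover have "(\<Sum>l<n. C $$ (i, l) * sqrt_iterate N k $$ (l, j)) = (\<Sum>l<n. sqrt_iterate N k $$ (i, l) * C $$ (l, j))" for k
        using arg_cong[OF sqrt_iterate_commute[OF N C(1) C(2), of k], of "\<lambda>B. B $$ (i, j)"]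
          index_mult_mat_sum[OF C(1) it ij] index_mult_mat_sum[OF it C(1) ij] by metis
      ultimately show "(C * Z) $$ (i, j) = (Z * C) $$ (i, j)"
        using LIMSEQ_unique index_mult_mat_sum[OF C(1) Z ij] index_mult_mat_sum[OF Z C(1) ij] by simp
    qed (use Z C in auto)
  qed
qed

text \<open>Off the diagonal, \<open>A\<close> is \<open>M\<close> across the parts and
  \<open>Z\<close> up to sign inside them, because \<open>Z\<close> commutes with \<open>K\<close>
  and so vanishes across. Inside a part \<open>Z\<close> is positive: by
  \<open>2 \<cdot>\<^sub>m Z = N + Z * Z\<close>, a walk of length two gives a positive entry and
  positivity is transitive, while connectedness joins vertices of one part by walks of even
  length.\<close>

lemma connected_bipartite_involution:
  fixes W :: "nat \<Rightarrow> nat \<Rightarrow> bool" and P :: "nat \<Rightarrow> bool"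
  assumes W_sym: "\<And>i j. W i j \<Longrightarrow> W j i"
    and W_bip: "\<And>i j. W i j \<Longrightarrow> P i \<noteq> P j"
    and conn: "\<And>i j. i < n \<Longrightarrow> j < n \<Longrightarrow> (i, j) \<in> {(i, j). i < n \<and> j < n \<and> W i j}\<^sup>*"
  obtains A :: "real mat" where "A \<in> carrier_mat n n" "transpose_mat A = A" "A * A = 1\<^sub>m n"
    "\<And>i j. i < n \<Longrightarrow> j < n \<Longrightarrow> i \<noteq> j \<Longrightarrow> A $$ (i, j) \<noteq> 0 \<longleftrightarrow> P i = P j \<or> W i j"
proof -
  \<comment> \<open>The factor \<open>1 / real n\<close> keeps the row sums of \<open>M\<close>, and
    hence of \<open>M * M\<close>, at most 1.\<close>
  define M where "M = mat n n (\<lambda>(i, j). if W i j then 1 / real n else 0)"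
  define K where "K = mat n n (\<lambda>(i, j). if i = j then if P i then 1 else - 1 else 0 :: real)"
  define N where "N = M * M"
  have M: "M \<in> carrier_mat n n" and K: "K \<in> carrier_mat n n" and N: "N \<in> carrier_mat n n"
    by (auto simp: M_def K_def N_def)
  note [simp] = assoc_mult_mat[of _ n n _ n _ n]
  have M_sym: "transpose_mat M = M"
    using W_sym by (intro eq_matI) (auto simp: M_def)
  have K_left: "(K * S) $$ (i, j) = K $$ (i, i) * S $$ (i, j)"
    and K_right: "(S * K) $$ (i, j) = S $$ (i, j) * K $$ (j, j)"
    if "S \<in> carrier_mat n n" "i < n" "j < n" for S i j
  proof -
    have "(K * S) $$ (i, j) = (\<Sum>l<n. if l = i then K $$ (i, i) * S $$ (i, j) else 0)"
      unfolding index_mult_mat_sum[OF K that] using that by (intro sum.cong) (auto simp: K_def)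
    then show "(K * S) $$ (i, j) = K $$ (i, i) * S $$ (i, j)" using that by simp
    have "(S * K) $$ (i, j) = (\<Sum>l<n. if l = j then S $$ (i, j) * K $$ (j, j) else 0)"
      unfolding index_mult_mat_sum[OF that(1) K that(2,3)] using that by (intro sum.cong) (auto simp: K_def)
    then show "(S * K) $$ (i, j) = S $$ (i, j) * K $$ (j, j)" using that by simp
  qed
  have KK: "K * K = 1\<^sub>m n"
    by (rule eq_matI) (use K in \<open>auto simp: K_left[OF K] simp del: index_mult_mat(1)\<close>, auto simp: K_def)
  have KM: "K * M = - (M * K)"
  proof (rule eq_matI)
    fix i j assume "i < dim_row (- (M * K))" "j < dim_col (- (M * K))"
    then have ij: "i < n" "j < n" using M K by auto
    have "K $$ (i, i) * M $$ (i, j) = - (M $$ (i, j) * K $$ (j, j))"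
      using ij W_bip[of i j] by (auto simp: M_def K_def)
    then show "(K * M) $$ (i, j) = (- (M * K)) $$ (i, j)"
      using ij M K K_left[OF M ij] K_right[OF M ij] by (simp del: index_mult_mat(1))
  qed (use M K in auto)
  have KN: "K * N = N * K"
  proof -
    have "K * N = (K * M) * M" using K M by (simp add: N_def)
    also have "\<dots> = - (M * (K * M))" using K M by (simp add: KM)
    also have "\<dots> = M * (M * K)" using K M by (simp add: KM)
    finally show ?thesis using K M by (simp add: N_def)
  qed
  have M_nonneg: "M $$ (i, j) \<ge> 0" if "i < n" "j < n" for i j
    using that by (simp add: M_def)
  have M_row: "(\<Sum>j<n. M $$ (i, j)) \<le> 1" if "i < n" for i
  proof -
    have "(\<Sum>j<n. M $$ (i, j)) \<le> (\<Sum>j<n. 1 / real n)"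
      using that by (intro sum_mono) (auto simp: M_def)
    then show ?thesis using that by simp
  qed
  have N_row: "(\<Sum>j<n. N $$ (i, j)) \<le> 1" if i: "i < n" for i
  proof -
    have "(\<Sum>j<n. N $$ (i, j)) = (\<Sum>j<n. \<Sum>l<n. M $$ (i, l) * M $$ (l, j))"
      using i by (simp add: N_def index_mult_mat_sum[OF M M] del: index_mult_mat(1))
    also have "\<dots> = (\<Sum>l<n. M $$ (i, l) * (\<Sum>j<n. M $$ (l, j)))"
      by (subst sum.swap) (simp add: sum_distrib_left)
    also have "\<dots> \<le> (\<Sum>l<n. M $$ (i, l) * 1)"
      using i M_row M_nonneg by (intro sum_mono mult_left_mono) auto
    also have "\<dots> \<le> 1" using M_row i by simp
    finally show ?thesis .
  qed
  have N_nonneg: "N $$ (i, j) \<ge> 0" if "i < n" "j < n" for i j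
    unfolding N_def index_mult_mat_sum[OF M M that] using that M_nonneg by (intro sum_nonneg) simp
  have "transpose_mat N = N" using M by (simp add: N_def transpose_mult[of _ n n _ n] M_sym)
  from nonneg_sqrt_complement[OF N this N_nonneg N_row]
  obtain Z where Z: "Z \<in> carrier_mat n n" and Z_sym: "transpose_mat Z = Z"
    and Z_nonneg: "\<And>i j. i < n \<Longrightarrow> j < n \<Longrightarrow> Z $$ (i, j) \<ge> 0"
    and Z_eq: "2 \<cdot>\<^sub>m Z = N + Z * Z"
    and Z_comm: "\<And>C. C \<in> carrier_mat n n \<Longrightarrow> C * N = N * C \<Longrightarrow> C * Z = Z * C" by metis
  have KZ: "K * Z = Z * K" by (rule Z_comm[OF K KN])
  have MZ: "M * Z = Z * M" using M by (intro Z_comm) (auto simp: N_def)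
  have Z_cross: "Z $$ (i, j) = 0" if "i < n" "j < n" "P i \<noteq> P j" for i j
  proof -
    have "K $$ (i, i) * Z $$ (i, j) = Z $$ (i, j) * K $$ (j, j)"
      using arg_cong[OF KZ, of "\<lambda>B. B $$ (i, j)"] that K_left[OF Z] K_right[OF Z] by simp
    then show ?thesis using that by (auto simp: K_def split: if_splits)
  qed
  have Z2: "2 * Z $$ (i, j) = N $$ (i, j) + (\<Sum>l<n. Z $$ (i, l) * Z $$ (l, j))" if "i < n" "j < n" for i j
    using arg_cong[OF Z_eq, of "\<lambda>B. B $$ (i, j)"] that Z N
    by (simp add: index_mult_mat_sum[OF Z Z] del: index_mult_mat(1))
  have Z_W: "Z $$ (i, j) > 0" if "i < n" "j < n" "l < n" "W i l" "W l j" for i j l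
  proof -
    have "N $$ (i, j) > 0"
      unfolding N_def index_mult_mat_sum[OF M M that(1,2)]
      using that M_nonneg by (intro sum_pos2[of _ l]) (auto simp: M_def)
    moreover have "(\<Sum>l<n. Z $$ (i, l) * Z $$ (l, j)) \<ge> 0"
      using that Z_nonneg by (intro sum_nonneg) auto
    ultimately show ?thesis using Z2[OF that(1,2)] by linarith
  qed
  have Z_trans: "Z $$ (i, j) > 0" if "i < n" "j < n" "l < n" "Z $$ (i, l) > 0" "Z $$ (l, j) > 0" for i j l
  proof -
    have "(\<Sum>l<n. Z $$ (i, l) * Z $$ (l, j)) > 0"
      using that Z_nonneg by (intro sum_pos2[of _ l]) auto
    then show ?thesis using Z2[OF that(1,2)] N_nonneg[OF that(1,2)] by linarith
  qed
  have Z_pos: "Z $$ (i, j) > 0" if ij: "i < n" "j < n" "i \<noteq> j" "P i = P j" for i j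
  proof -
    \<comment> \<open>Invariant along a walk from \<open>i\<close>: after an even number of steps
      the entry of \<open>Z\<close> is positive or the walk is back at \<open>i\<close>; after an
      odd number the end is a \<open>W\<close>-neighbour of such a vertex.\<close>
    have "(if P i = P j then i = j \<or> Z $$ (i, j) > 0
           else \<exists>l<n. W l j \<and> (i = l \<or> Z $$ (i, l) > 0))"
      using conn[OF ij(1,2)]
    proof (induction rule: rtrancl_induct)
      case base
      then show ?case by simp
    next
      case (step j k)
      then have jk: "j < n" "k < n" "W j k" "P j \<noteq> P k" using W_bip by auto
      show ?case
      proof (cases "P i = P j")
        case True
        then show ?thesis using step.IH jk by auto
      next
        case False
        with step.IH obtain l where l: "l < n" "W l j" "i = l \<or> Z $$ (i, l) > 0" by auto
        have "Z $$ (l, k) > 0" using Z_W[OF l(1) jk(2) jk(1) l(2) jk(3)] .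
        then show ?thesis using l Z_trans[OF ij(1) jk(2) l(1)] False jk(4) by auto
      qed
    qed
    then show ?thesis using ij by simp
  qed
  define S where "S = 1\<^sub>m n - Z"
  have S: "S \<in> carrier_mat n n" using Z by (simp add: S_def minus_carrier_mat)
  have KS: "K * S = S * K" and MS: "M * S = S * M"
    using K M Z by (simp_all add: S_def KZ MZ mult_minus_distrib_mat[of _ n n _ n] minus_mult_distrib_mat[of _ n n _ _ n])
  have SS: "S * S = 1\<^sub>m n - N"
  proof -
    have "S * S = (1\<^sub>m n - Z) - (Z - Z * Z)"
      using Z unfolding S_def
      by (simp add: mult_minus_distrib_mat[of _ n n _ n] minus_mult_distrib_mat[of _ n n _ _ n] minus_carrier_mat)
    also have "\<dots> = 1\<^sub>m n - N"
      using Z N Z2 by (intro eq_matI) (auto simp: index_mult_mat_sum[OF Z Z] simp del: index_mult_mat(1))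
    finally show ?thesis .
  qed
  define A where "A = M + K * S"
  \<comment> \<open>The mixed terms will cancel, since \<open>K * S\<close> anticommutes with
    \<open>M\<close>. What remains is \<open>N + S * S = 1\<^sub>m n\<close>.\<close>
  have "A * A = (M * M + M * (K * S)) + ((K * S) * M + (K * S) * (K * S))"
  proof -
    have L: "K * S \<in> carrier_mat n n" using K S by simp
    show ?thesis
      unfolding A_def add_mult_distrib_mat[OF M L add_carrier_mat[OF L]]
        mult_add_distrib_mat[OF M M L] mult_add_distrib_mat[OF L M L] ..
  qed
  also have "M * (K * S) = - ((K * S) * M)"
  proof -
    have "(K * S) * M = (K * M) * S" using M K S by (simp add: MS)
    then show ?thesis using M K S by (simp add: KM)
  qed
  also have "(K * S) * (K * S) = S * S"
  proof -
    have "(K * S) * (K * S) = (S * K) * (K * S)" using KS by metis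
    also have "\<dots> = S * ((K * K) * S)" using K S by simp
    finally show ?thesis using S by (simp add: KK)
  qed
  also have "(M * M + - (K * S * M)) + (K * S * M + S * S) = 1\<^sub>m n"
    unfolding SS N_def[symmetric] using N K S M by (intro eq_matI) auto
  finally have AA: "A * A = 1\<^sub>m n" .
  have A_entry: "A $$ (i, j) = M $$ (i, j) + K $$ (i, i) * ((if i = j then 1 else 0) - Z $$ (i, j))"
    if "i < n" "j < n" for i j
      proof -
    have "A $$ (i, j) = M $$ (i, j) + K $$ (i, i) * S $$ (i, j)"
      using that M K S K_left[OF S that] by (simp add: A_def del: index_mult_mat(1))
    then show ?thesis using that Z by (simp add: S_def)
  qed
  have A: "A \<in> carrier_mat n n" using M K S by (simp add: A_def)
  show thesis
  proof
    show "A \<in> carrier_mat n n" "A * A = 1\<^sub>m n" by fact+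
    have "transpose_mat S = S"
      using Z Z_sym by (simp add: S_def transpose_minus[of _ n n])
    moreover have "transpose_mat K = K" by (rule eq_matI) (auto simp: K_def)
    ultimately show "transpose_mat A = A"
      using M K S by (simp add: A_def transpose_add[of _ n n] transpose_mult[of _ n n _ n] M_sym KS)
    fix i j assume ij: "i < n" "j < n" "i \<noteq> j"
    show "A $$ (i, j) \<noteq> 0 \<longleftrightarrow> P i = P j \<or> W i j"
    proof (cases "P i = P j")
      case True
      then have "\<not> W i j" using W_bip by blast
      then show ?thesis using True ij Z_pos[OF ij True] A_entry[of i j] by (auto simp: M_def K_def)
    next
      case False
      then show ?thesis using ij Z_cross[OF ij(1,2) False] A_entry[of i j] by (auto simp: M_def)
    qed
  qed
qed

section \<open>Bounds on q\<close>

lemma spectrum_finite: "A \<in> sym_matrices G \<Longrightarrow> finite (spectrum A)"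
  unfolding sym_matrices_def using card_finite_spectrum(1) by blast

lemma q_mat_ge_2:
  assumes "A \<in> sym_matrices G" "verts G = {..<n}" "i < n" "j < n" "i \<noteq> j" "{i, j} \<in> edges G"
  shows "q_mat A \<ge> 2"
proof (rule ccontr)
  assume "\<not> q_mat A \<ge> 2"
  then have "card (spectrum A) = 0 \<or> card (spectrum A) = 1" by (auto simp: q_mat_def)
  then obtain a where "spectrum A \<subseteq> {a}"
    using spectrum_finite[OF assms(1)] by (auto simp: card_1_singleton_iff)
  then have "A $$ (i, j) = 0"
    using assms by (intro real_symmetric_one_eigenvalue) (auto simp: sym_matrices_def)
  then show False using assms by (auto simp: sym_matrices_def)
qed

text \<open>The entry \<open>(u, v)\<close> of \<open>A * A\<close> has the single nonzero term
  through \<open>w\<close>, but under a quadratic relation it would be a multiple of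
  \<open>A $$ (u, v) = 0\<close>.\<close>

lemma q_mat_ge_3:
  assumes A: "A \<in> sym_matrices G" and V: "verts G = {..<n}"
    and "u < n" "v < n" "w < n" "distinct [u, v, w]"
    and uv: "{u, v} \<notin> edges G" and uw: "{u, w} \<in> edges G" and wv: "{w, v} \<in> edges G"
    and only: "\<And>l. l < n \<Longrightarrow> l \<notin> {u, v, w} \<Longrightarrow> {u, l} \<in> edges G \<Longrightarrow> {l, v} \<in> edges G \<Longrightarrow> False"
  shows "q_mat A \<ge> 3"
proof (rule ccontr)
  assume *: "\<not> q_mat A \<ge> 3"
  have "\<exists>a b. spectrum A \<subseteq> {a, b}"
  proof -
    have "card (spectrum A) = 0 \<or> card (spectrum A) = 1 \<or> card (spectrum A) = 2"
      using * by (auto simp: q_mat_def)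
    then show ?thesis
      using spectrum_finite[OF A] by (elim disjE) (auto simp: card_1_singleton_iff card_2_iff)
  qed
  then obtain a b where sp: "spectrum A \<subseteq> {a, b}" by blast
  have car: "A \<in> carrier_mat n n" and sym: "transpose_mat A = A"
    and pat: "\<And>i j. i < n \<Longrightarrow> j < n \<Longrightarrow> i \<noteq> j \<Longrightarrow> A $$ (i, j) \<noteq> 0 \<longleftrightarrow> {i, j} \<in> edges G"
    using A V by (auto simp: sym_matrices_def)
  \<comment> \<open>The terms at \<open>l = u\<close> and \<open>l = v\<close> contain the factor
    \<open>A $$ (u, v) = 0\<close>, whatever the diagonal entries are.\<close>
  have "(\<Sum>l<n. A $$ (u, l) * A $$ (l, v)) = (\<Sum>l<n. if l = w then A $$ (u, w) * A $$ (w, v) else 0)"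
  proof (intro sum.cong refl)
    fix l assume l: "l \<in> {..<n}"
    show "A $$ (u, l) * A $$ (l, v) = (if l = w then A $$ (u, w) * A $$ (w, v) else 0)"
      using pat[of u l] pat[of l v] pat[of u v] assms l by (cases "l \<in> {u, v, w}") auto
  qed
  also have "\<dots> = A $$ (u, w) * A $$ (w, v)" using assms by simp
  also have "\<dots> \<noteq> 0" using pat[of u w] pat[of w v] assms by auto
  finally show False
    using real_symmetric_two_eigenvalues[OF car sym sp, of u v] pat[of u v] assms by auto
qed

section \<open>Upper bounds from matrices with the prescribed zero pattern\<close>

lemma edges_graph_complement:
  assumes "simple_graph G" "verts G = {..<n}" "i < n" "j < n" "i \<noteq> j"
  shows "{i, j} \<in> edges G \<longleftrightarrow> {i, j} \<notin> edges (graph_complement G)"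
  using assms by (auto simp: graph_complement_def all_pairs_def)

lemma q_graph_le_card_spectrum:
  fixes A :: "real mat"
  assumes "simple_graph G" "verts G = {..<n}" "A \<in> carrier_mat n n" "transpose_mat A = A"
    and "\<And>i j. i < n \<Longrightarrow> j < n \<Longrightarrow> i \<noteq> j \<Longrightarrow> A $$ (i, j) \<noteq> 0 \<longleftrightarrow> {i, j} \<notin> edges (graph_complement G)"
  shows "q_graph G \<le> card (spectrum A)"
proof -
  have "A \<in> sym_matrices G"
    using assms edges_graph_complement[OF assms(1,2)] by (auto simp: sym_matrices_def)
  then show ?thesis using q_graph_le by (metis q_mat_def)
qed

text \<open>Vertex \<open>i\<close> is represented by the vector \<open>(f i, g i, h i)\<close>,
  with orthogonality exactly along the edges of the complement. A bound of 2 or 3 results when the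
  parameters make some of the four values coincide.\<close>

lemma q_graph_le_gram:
  fixes f g h :: "nat \<Rightarrow> real"
  assumes "simple_graph G" "verts G = {..<n}"
    and gram: "(\<Sum>i<n. f i * f i) = \<alpha>" "(\<Sum>i<n. g i * g i) = \<alpha>" "(\<Sum>i<n. f i * g i) = \<delta>"
      "(\<Sum>i<n. f i * h i) = 0" "(\<Sum>i<n. g i * h i) = 0" "(\<Sum>i<n. h i * h i) = \<gamma>"
    and pat: "\<And>i j. i < n \<Longrightarrow> j < n \<Longrightarrow> i \<noteq> j \<Longrightarrow>
      f i * f j + g i * g j + h i * h j = 0 \<longleftrightarrow> {i, j} \<in> edges (graph_complement G)"
  shows "q_graph G \<le> card {0, \<alpha> + \<delta>, \<alpha> - \<delta>, \<gamma>}"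
proof -
  define A where "A = mat n n (\<lambda>(i, j). f i * f j + g i * g j + h i * h j)"
  have "transpose_mat A = A" by (rule eq_matI) (auto simp: A_def mult.commute)
  then have "q_graph G \<le> card (spectrum A)"
    using pat by (intro q_graph_le_card_spectrum[OF assms(1,2)]) (auto simp: A_def)
  also have "\<dots> \<le> card {0, \<alpha> + \<delta>, \<alpha> - \<delta>, \<gamma>}"
    unfolding A_def by (intro card_mono spectrum_gram[OF gram]) simp
  finally show ?thesis .
qed

section \<open>Bipartite complements\<close>

text \<open>The witnesses of \<open>bipartite\<close> become parameters, so that the parts can be
  swapped and an isolated vertex can change sides.\<close>

definition bipartition :: "'a set set \<Rightarrow> 'a set \<Rightarrow> 'a set \<Rightarrow> 'a set \<Rightarrow> bool" where
  "bipartition E V P Q \<longleftrightarrow> P \<union> Q = V \<and> P \<inter> Q = {} \<and> (\<forall>e\<in>E. \<exists>p\<in>P. \<exists>q\<in>Q. e = {p, q})"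

lemma bipartition_edgeE:
  assumes "bipartition E V P Q" "e \<in> E"
  obtains p q where "p \<in> P" "q \<in> Q" "e = {p, q}"
proof -
  have "\<exists>p\<in>P. \<exists>q\<in>Q. e = {p, q}" using assms by (simp add: bipartition_def)
  then show thesis using that by (elim bexE)
qed

lemma bipartition_swap:
  assumes "bipartition E V P Q"
  shows "bipartition E V Q P"
proof -
  have "\<exists>q\<in>Q. \<exists>p\<in>P. e = {q, p}" if "e \<in> E" for e
  proof -
    obtain p q where "p \<in> P" "q \<in> Q" "e = {p, q}" by (rule bipartition_edgeE[OF assms \<open>e \<in> E\<close>])
    moreover from this have "e = {q, p}" by auto
    ultimately show ?thesis by blast
  qed
  then show ?thesis using assms by (auto simp: bipartition_def)
qed

section \<open>Counting edges across a bipartition\<close>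

lemma inj_on_edge:
  assumes "P \<inter> Q = {}"
  shows "inj_on (\<lambda>(p, q). {p, q}) (P \<times> Q)"
  using assms by (auto simp: inj_on_def doubleton_eq_iff)

lemma card_edges_ge:
  assumes "finite E" "P \<inter> Q = {}" "S \<subseteq> P \<times> Q" "\<And>p q. (p, q) \<in> S \<Longrightarrow> {p, q} \<in> E"
  shows "card S \<le> card E"
    and "card E \<le> card S \<Longrightarrow> E = (\<lambda>(p, q). {p, q}) ` S"
proof -
  have inj: "inj_on (\<lambda>(p, q). {p, q}) S"
    using inj_on_edge[OF assms(2)] assms(3) inj_on_subset by blast
  have sub: "(\<lambda>(p, q). {p, q}) ` S \<subseteq> E" using assms(4) by auto
  show "card S \<le> card E" using card_mono[OF assms(1) sub] card_image[OF inj] by simp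
  show "E = (\<lambda>(p, q). {p, q}) ` S" if "card E \<le> card S"
    using card_subset_eq[OF assms(1) sub] card_mono[OF assms(1) sub] card_image[OF inj] that by simp
qed

text \<open>The relation is adjacency in \<Gamma>. Pairs inside a part are all edges of
  \<open>G\<close>, so the involution built from \<Gamma> has the pattern of
  \<open>G\<close>.\<close>

lemma q_graph_le_2_of_connected:
  assumes G: "simple_graph G" "verts G = {..<n}"
    and bip: "bipartition (edges (graph_complement G)) {..<n} P Q"
    and conn: "\<And>i j. i < n \<Longrightarrow> j < n \<Longrightarrow>
      (i, j) \<in> {(i, j). i < n \<and> j < n \<and> (i \<in> P) \<noteq> (j \<in> P) \<and> {i, j} \<notin> edges (graph_complement G)}\<^sup>*"
  shows "q_graph G \<le> 2"
proof -
  define W where "W = (\<lambda>i j. (i \<in> P) \<noteq> (j \<in> P) \<and> {i, j} \<notin> edges (graph_complement G))"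
  have W_conn: "(i, j) \<in> {(i, j). i < n \<and> j < n \<and> W i j}\<^sup>*" if "i < n" "j < n" for i j
    using conn[OF that] by (simp add: W_def)
  have W_sym: "W j i" and W_bip: "(i \<in> P) \<noteq> (j \<in> P)" if "W i j" for i j
    using that by (auto simp: W_def insert_commute)
  show ?thesis
  proof (rule connected_bipartite_involution[of W "\<lambda>i. i \<in> P" n, OF W_sym W_bip W_conn])
    fix A :: "real mat"
    assume A: "A \<in> carrier_mat n n" "transpose_mat A = A" "A * A = 1\<^sub>m n"
      "\<And>i j. i < n \<Longrightarrow> j < n \<Longrightarrow> i \<noteq> j \<Longrightarrow> A $$ (i, j) \<noteq> 0 \<longleftrightarrow> (i \<in> P) = (j \<in> P) \<or> W i j"
    have "q_graph G \<le> card (spectrum A)"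
    proof (rule q_graph_le_card_spectrum[OF G A(1,2)])
      fix i j assume "i < n" "j < n" "i \<noteq> j"
      moreover have "{i, j} \<notin> edges (graph_complement G)" if "(i \<in> P) = (j \<in> P)"
      proof
        assume "{i, j} \<in> edges (graph_complement G)"
        then obtain p q where "p \<in> P" "q \<in> Q" "{i, j} = {p, q}"
          by (rule bipartition_edgeE[OF bip])
        then show False using that bip by (auto simp: bipartition_def doubleton_eq_iff)
      qed
      ultimately show "A $$ (i, j) \<noteq> 0 \<longleftrightarrow> {i, j} \<notin> edges (graph_complement G)"
        using A(4)[of i j] by (auto simp: W_def)
    qed
    also have "\<dots> \<le> card {1, - 1 :: real}"
      by (intro card_mono spectrum_involution[OF A(1,3)]) simp
    finally show ?thesis by simp
  qed
qed

text \<open>In \<Gamma> the vertex \<open>w\<close> is joined to all of \<open>Q\<close>, and each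
  vertex of \<open>P\<close> to some vertex of \<open>Q\<close>, so every vertex is connected to
  \<open>w\<close>.\<close>

lemma isolated_vertex_connected:
  assumes G: "simple_graph G" "verts G = {..<n}"
    and bip: "bipartition (edges (graph_complement G)) {..<n} P Q"
    and w: "w \<in> P" "\<And>e. e \<in> edges (graph_complement G) \<Longrightarrow> w \<notin> e"
    and nbr: "\<And>p. p \<in> P \<Longrightarrow> \<exists>q\<in>Q. {p, q} \<notin> edges (graph_complement G)"
  shows "q_graph G \<le> 2"
proof (rule q_graph_le_2_of_connected[OF G bip])
  define R where "R = {(i, j). i < n \<and> j < n \<and> (i \<in> P) \<noteq> (j \<in> P) \<and> {i, j} \<notin> edges (graph_complement G)}"
  have PQ: "P \<union> Q = {..<n}" "P \<inter> Q = {}" using bip by (auto simp: bipartition_def)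
  have sym: "(j, i) \<in> R" if "(i, j) \<in> R" for i j using that by (auto simp: R_def insert_commute)
  have Q: "(w, q) \<in> R" if "q \<in> Q" for q
    using that PQ w unfolding R_def by blast
  have "(w, i) \<in> R\<^sup>*" if "i < n" for i
  proof (cases "i \<in> P")
    case True
    then obtain q where q: "q \<in> Q" "{i, q} \<notin> edges (graph_complement G)" using nbr by blast
    then have "(i, q) \<in> R" using True PQ unfolding R_def by blast
    then show ?thesis using Q[OF q(1)] sym by (meson converse_rtrancl_into_rtrancl r_into_rtrancl)
  next
    case False
    then show ?thesis using Q that PQ by blast
  qed
  moreover have "sym (R\<^sup>*)" using sym by (intro sym_rtrancl) (auto simp: sym_def)
  ultimately have "(i, j) \<in> R\<^sup>*" if "i < n" "j < n" for i j
    using that by (meson symD rtrancl_trans)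
  then show "(i, j) \<in> {(i, j). i < n \<and> j < n \<and> (i \<in> P) \<noteq> (j \<in> P) \<and> {i, j} \<notin> edges (graph_complement G)}\<^sup>*"
    if "i < n" "j < n" for i j
    using that unfolding R_def by blast
qed

text \<open>The edges from \<open>q\<close> to all of \<open>P\<close>, with one edge at each other
  vertex of \<open>Q\<close>, form a spanning tree, which needs \<open>card V - 1\<close>
  edges.\<close>

lemma no_full_vertex:
  assumes fin: "finite V" and bip: "bipartition E V P Q" and E: "finite E" "card E < card V - 1"
    and no_iso: "\<And>v. v \<in> V \<Longrightarrow> \<exists>e\<in>E. v \<in> e"
    and q: "q \<in> Q" "\<And>p. p \<in> P \<Longrightarrow> {p, q} \<in> E"
  shows False
proof -
  have PQ: "P \<union> Q = V" "P \<inter> Q = {}" using bip by (auto simp: bipartition_def)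
  have finPQ: "finite P" "finite Q" using fin PQ(1) by auto
  have "\<exists>p\<in>P. {p, r} \<in> E" if r: "r \<in> Q" for r
  proof -
    obtain e where "e \<in> E" "r \<in> e" using no_iso r PQ by blast
    moreover from this(1) obtain p s where "p \<in> P" "s \<in> Q" "e = {p, s}" by (rule bipartition_edgeE[OF bip])
    ultimately show ?thesis using r PQ by auto
  qed
  then obtain g where g: "\<And>r. r \<in> Q \<Longrightarrow> g r \<in> P" "\<And>r. r \<in> Q \<Longrightarrow> {g r, r} \<in> E" by metis
  define S where "S = P \<times> {q} \<union> (\<lambda>r. (g r, r)) ` (Q - {q})"
  have "card S = card (P \<times> {q}) + card ((\<lambda>r. (g r, r)) ` (Q - {q}))"
    unfolding S_def using finPQ by (intro card_Un_disjoint) auto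
  also have "card ((\<lambda>r. (g r, r)) ` (Q - {q})) = card (Q - {q})"
    by (rule card_image) (auto simp: inj_on_def)
  also have "card (P \<times> {q}) + card (Q - {q}) = card P + (card Q - 1)"
    using q(1) finPQ by (simp add: card_cartesian_product)
  also have "\<dots> = card V - 1"
  proof -
    have "card Q \<ge> 1" using q(1) finPQ by (auto simp: Suc_le_eq card_gt_0_iff)
    then show ?thesis using card_Un_disjoint[OF finPQ PQ(2)] PQ(1) by simp
  qed
  finally have "card S = card V - 1" .
  moreover have "card S \<le> card E"
    using q g by (intro card_edges_ge(1)[OF E(1) PQ(2)]) (auto simp: S_def)
  ultimately show False using E(2) by simp
qed

text \<open>The vectors lie on two pairs of orthogonal lines in the plane: the axes for
  \<open>P1\<close> and \<open>Q2\<close>, the diagonals for \<open>P2\<close> and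
  \<open>Q1\<close>. No other pair of these lines is orthogonal.\<close>

lemma two_complete_bipartite_q_le_2:
  fixes n :: nat
  assumes G: "simple_graph G" "verts G = {..<n}"
    and V: "P1 \<union> P2 \<union> Q1 \<union> Q2 = {..<n}"
    and disj: "P1 \<inter> P2 = {}" "P1 \<inter> Q1 = {}" "P1 \<inter> Q2 = {}" "P2 \<inter> Q1 = {}" "P2 \<inter> Q2 = {}" "Q1 \<inter> Q2 = {}"
    and ne: "P1 \<noteq> {}" "P2 \<noteq> {}" "Q1 \<noteq> {}" "Q2 \<noteq> {}"
    and E: "edges (graph_complement G) = (\<lambda>(p, q). {p, q}) ` (P1 \<times> Q2 \<union> P2 \<times> Q1)"
  shows "q_graph G \<le> 2"
proof -
  have fin: "finite P1" "finite P2" "finite Q1" "finite Q2"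
    using V by (auto intro: finite_subset[of _ "{..<n}"])
  \<comment> \<open>The lengths make the frame tight: the diagonals have equal total weight, so
    \<open>f\<close> and \<open>g\<close> are orthogonal, and both have squared norm 2. Only the
    eigenvalues 0 and 2 remain.\<close>
  obtain p q r s :: real where pos: "p > 0" "q > 0" "r > 0" "s > 0"
    and norm: "card P1 * (p * p) = 1" "card P2 * (q * q) = 1 / 2" "card Q1 * (r * r) = 1 / 2" "card Q2 * (s * s) = 1"
  proof
    show "1 / sqrt (card P1) > 0" "1 / sqrt (2 * card P2) > 0" "1 / sqrt (2 * card Q1) > 0" "1 / sqrt (card Q2) > 0"
      using fin ne by (simp_all add: card_gt_0_iff)
  qed (use fin ne in \<open>simp_all add: card_gt_0_iff field_simps\<close>)
  define f where "f = (\<lambda>i. if i \<in> P1 then p else if i \<in> P2 then q else if i \<in> Q1 then r else 0)"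
  define g where "g = (\<lambda>i. if i \<in> P1 then 0 else if i \<in> P2 then q else if i \<in> Q1 then - r else s)"
  have f: "i \<in> P1 \<Longrightarrow> f i = p" "i \<in> P2 \<Longrightarrow> f i = q" "i \<in> Q1 \<Longrightarrow> f i = r" "i \<in> Q2 \<Longrightarrow> f i = 0"
    and g: "i \<in> P1 \<Longrightarrow> g i = 0" "i \<in> P2 \<Longrightarrow> g i = q" "i \<in> Q1 \<Longrightarrow> g i = - r" "i \<in> Q2 \<Longrightarrow> g i = s" for i
    using disj by (auto simp: f_def g_def)
  have split: "(\<Sum>i<n. t i) = (\<Sum>i\<in>P1. t i) + (\<Sum>i\<in>P2. t i) + (\<Sum>i\<in>Q1. t i) + (\<Sum>i\<in>Q2. t i)" for t :: "nat \<Rightarrow> real"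
  proof -
    have "sum t (P1 \<union> P2 \<union> Q1 \<union> Q2) = sum t (P1 \<union> P2 \<union> Q1) + sum t Q2"
      using fin disj by (intro sum.union_disjoint) auto
    also have "sum t (P1 \<union> P2 \<union> Q1) = sum t (P1 \<union> P2) + sum t Q1"
      using fin disj by (intro sum.union_disjoint) auto
    also have "sum t (P1 \<union> P2) = sum t P1 + sum t P2"
      using fin disj by (intro sum.union_disjoint) auto
    finally show ?thesis unfolding V .
  qed
  have "q_graph G \<le> card {0, 2 + 0, 2 - 0, 0 :: real}"
  proof (rule q_graph_le_gram[OF G, of f _ g _ "\<lambda>_. 0"])
    show "(\<Sum>i<n. f i * f i) = 2" "(\<Sum>i<n. g i * g i) = 2" "(\<Sum>i<n. f i * g i) = 0"
      unfolding split using norm by (simp_all add: f g)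
    fix i j assume ij: "i < n" "j < n" "i \<noteq> j"
    have edge: "{i, j} \<in> edges (graph_complement G) \<longleftrightarrow>
        i \<in> P1 \<and> j \<in> Q2 \<or> j \<in> P1 \<and> i \<in> Q2 \<or> i \<in> P2 \<and> j \<in> Q1 \<or> j \<in> P2 \<and> i \<in> Q1"
    proof -
      have *: "{i, j} \<in> (\<lambda>(p, q). {p, q}) ` T \<longleftrightarrow> (i, j) \<in> T \<or> (j, i) \<in> T" for T :: "(nat \<times> nat) set"
        by (force simp: doubleton_eq_iff)
      show ?thesis unfolding E * by auto
    qed
    have cases: "k \<in> P1 \<and> k \<notin> P2 \<and> k \<notin> Q1 \<and> k \<notin> Q2 \<and> f k = p \<and> g k = 0 \<or>
        k \<notin> P1 \<and> k \<in> P2 \<and> k \<notin> Q1 \<and> k \<notin> Q2 \<and> f k = q \<and> g k = q \<or>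
        k \<notin> P1 \<and> k \<notin> P2 \<and> k \<in> Q1 \<and> k \<notin> Q2 \<and> f k = r \<and> g k = - r \<or>
        k \<notin> P1 \<and> k \<notin> P2 \<and> k \<notin> Q1 \<and> k \<in> Q2 \<and> f k = 0 \<and> g k = s" if "k < n" for k
    proof -
      have "k \<in> P1 \<or> k \<in> P2 \<or> k \<in> Q1 \<or> k \<in> Q2" using that V by blast
      then show ?thesis using disj unfolding f_def g_def by (elim disjE) auto
    qed
    show "f i * f j + g i * g j + 0 * 0 = 0 \<longleftrightarrow> {i, j} \<in> edges (graph_complement G)"
      unfolding edge using cases[OF ij(1)] cases[OF ij(2)] pos by (elim disjE conjE) simp_all
  qed auto
  then show ?thesis by (simp add: insert_commute)
qed

text \<open>If \<Gamma> is disconnected, let \<open>C\<close> be one of its components. All pairs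
  across the parts that \<open>C\<close> separates are edges of the complement, and they already
  number at least \<open>n - 2\<close>, so the complement is the union of two complete bipartite
  graphs.\<close>

lemma no_isolated_vertex_q_le_2:
  assumes G: "simple_graph G" "verts G = {..<n}"
    and bip: "bipartition (edges (graph_complement G)) {..<n} P Q"
    and card_E: "card (edges (graph_complement G)) = n - 2" and n: "n \<ge> 3"
    and no_iso: "\<And>v. v < n \<Longrightarrow> \<exists>e\<in>edges (graph_complement G). v \<in> e"
  shows "q_graph G \<le> 2"
proof (rule ccontr)
  assume not: "\<not> q_graph G \<le> 2"
  define E where "E = edges (graph_complement G)"
  have fin_E: "finite E" using G(2) by (auto simp: E_def graph_complement_def all_pairs_def)
  have PQ: "P \<union> Q = {..<n}" "P \<inter> Q = {}" using bip by (auto simp: bipartition_def)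
  have no_full: "\<exists>s\<in>S. {s, t} \<notin> E" if "bipartition E {..<n} S T" "t \<in> T" for S T t
  proof (rule ccontr)
    assume "\<not> (\<exists>s\<in>S. {s, t} \<notin> E)"
    then have full: "\<And>s. s \<in> S \<Longrightarrow> {s, t} \<in> E" by blast
    have "card E < card {..<n} - 1" using card_E n by (simp add: E_def)
    then show False
      using no_full_vertex[OF _ that(1) fin_E _ _ that(2) full] no_iso by (simp add: E_def)
  qed
  have no_full_Q: "\<exists>p\<in>P. {p, q} \<notin> E" if "q \<in> Q" for q
    using no_full bip that unfolding E_def by blast
  have no_full_P: "\<exists>q\<in>Q. {p, q} \<notin> E" if "p \<in> P" for p
    using no_full[OF _ that, of Q] bipartition_swap[OF bip] by (simp add: E_def insert_commute[of p])
  define R where "R = {(i, j). i < n \<and> j < n \<and> (i \<in> P) \<noteq> (j \<in> P) \<and> {i, j} \<notin> E}"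
  obtain i j where ij: "i < n" "j < n" "(i, j) \<notin> R\<^sup>*"
    using q_graph_le_2_of_connected[OF G bip] not unfolding R_def E_def by blast
  define C where "C = {k. (i, k) \<in> R\<^sup>*}"
  have C: "i \<in> C" "j \<notin> C" using ij by (auto simp: C_def)
  have closed: "{p, q} \<in> E" if "p \<in> P" "q \<in> Q" "(p \<in> C) \<noteq> (q \<in> C)" for p q
  proof (rule ccontr)
    assume "{p, q} \<notin> E"
    then have "(p, q) \<in> R" "(q, p) \<in> R"
      using that PQ by (auto simp: R_def insert_commute)
    then show False using that(3) unfolding C_def by (auto intro: rtrancl_into_rtrancl)
  qed
  define P1 P2 Q1 Q2 where "P1 = P \<inter> C" and "P2 = P - C" and "Q1 = Q \<inter> C" and "Q2 = Q - C"
  note defs = P1_def P2_def Q1_def Q2_def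
  have mixed_P: "\<exists>p\<in>P. (p \<in> C) = (q \<in> C)" if "q \<in> Q" for q
    using closed no_full_Q that by meson
  have mixed_Q: "\<exists>q\<in>Q. (p \<in> C) = (q \<in> C)" if "p \<in> P" for p
    using closed no_full_P that by meson
  have "i \<in> P \<or> i \<in> Q" "j \<in> P \<or> j \<in> Q" using ij(1,2) PQ(1) by auto
  \<comment> \<open>Each vertex has one of the opposite part on its own side of \<open>C\<close>, so
    \<open>i\<close> yields \<open>P1\<close> and \<open>Q1\<close>, and \<open>j\<close> yields
    \<open>P2\<close> and \<open>Q2\<close>.\<close>
  then have ne: "P1 \<noteq> {}" "P2 \<noteq> {}" "Q1 \<noteq> {}" "Q2 \<noteq> {}"
    using C mixed_P[of i] mixed_Q[of i] mixed_P[of j] mixed_Q[of j] unfolding defs by auto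
  have fin: "finite P1" "finite P2" "finite Q1" "finite Q2" "finite P" "finite Q"
    using PQ(1) unfolding defs by (auto intro: finite_subset[of _ "{..<n}"])
  have "card P + card Q = n" using card_Un_disjoint[OF fin(5,6) PQ(2)] PQ(1) by simp
  moreover have "card P = card P1 + card P2" "card Q = card Q1 + card Q2"
    unfolding defs using fin(5,6) by (auto simp: card_Int_Diff)
  ultimately have sum: "card P1 + card P2 + card Q1 + card Q2 = n" by simp
  \<comment> \<open>This is \<open>(a - 1) * (b - 1) \<ge> 0\<close>; used for both complete
    bipartite pieces, it loses 2 in total, which matches \<open>n - 2\<close>.\<close>
  have mult: "a + b \<le> a * b + 1" if "a \<ge> 1" "b \<ge> 1" for a b :: nat
    using that by (cases a; cases b) auto
  have pos: "card P1 \<ge> 1" "card P2 \<ge> 1" "card Q1 \<ge> 1" "card Q2 \<ge> 1"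
    using fin ne by (simp_all add: Suc_le_eq card_gt_0_iff)
  define S where "S = P1 \<times> Q2 \<union> P2 \<times> Q1"
  have "card S = card P1 * card Q2 + card P2 * card Q1"
    unfolding S_def using fin defs by (subst card_Un_disjoint) (auto simp: card_cartesian_product)
  then have "card E \<le> card S"
    using mult[OF pos(1,4)] mult[OF pos(2,3)] sum card_E unfolding E_def by linarith
  then have "E = (\<lambda>(p, q). {p, q}) ` S"
    using closed by (intro card_edges_ge(2)[OF fin_E PQ(2)]) (auto simp: S_def defs)
  then have "q_graph G \<le> 2"
    using PQ ne unfolding E_def S_def
    by (intro two_complete_bipartite_q_le_2[OF G, of P1 P2 Q1 Q2]) (auto simp: defs)
  with not show False by simp
qed

section \<open>Double stars\<close>

abbreviation double_star_K1 :: "nat \<Rightarrow> nat \<Rightarrow> (ds_vertex + unit) sgraph" where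
  "double_star_K1 a b \<equiv> disjoint_union (double_star a b) K1"

lemma verts_double_star_K1:
  "verts (double_star_K1 a b) = Inl ` ds_vertex.X ` {1..a} \<union> Inl ` ds_vertex.Y ` {1..b} \<union>
    {Inl ds_vertex.U, Inl ds_vertex.V, Inr ()}"
  by (auto simp: disjoint_union_def double_star_def K1_def)

lemma edges_double_star_K1:
  "edges (double_star_K1 a b) = (\<lambda>i. {Inl ds_vertex.U, Inl (ds_vertex.X i)}) ` {1..a} \<union>
    (\<lambda>j. {Inl ds_vertex.V, Inl (ds_vertex.Y j)}) ` {1..b} \<union> {{Inl ds_vertex.U, Inl ds_vertex.V}}"
proof -
  have "(\<lambda>e. Inl ` e) ` {{ds_vertex.X i, ds_vertex.U} |i. i \<in> {1..a}} =
      (\<lambda>i. {Inl ds_vertex.U, Inl (ds_vertex.X i) :: ds_vertex + unit}) ` {1..a}"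
    and "(\<lambda>e. Inl ` e) ` {{ds_vertex.Y j, ds_vertex.V} |j. j \<in> {1..b}} =
      (\<lambda>j. {Inl ds_vertex.V, Inl (ds_vertex.Y j) :: ds_vertex + unit}) ` {1..b}"
    unfolding Setcompr_eq_image image_image by (simp_all add: insert_commute)
  then show ?thesis by (simp add: disjoint_union_def double_star_def K1_def image_Un)
qed

lemma adjacent_double_star_K1:
  "{s, t} \<in> edges (double_star_K1 a b) \<longleftrightarrow>
    s = Inl ds_vertex.U \<and> (t = Inl ds_vertex.V \<or> t \<in> Inl ` ds_vertex.X ` {1..a}) \<or>
    t = Inl ds_vertex.U \<and> (s = Inl ds_vertex.V \<or> s \<in> Inl ` ds_vertex.X ` {1..a}) \<or>
    s = Inl ds_vertex.V \<and> t \<in> Inl ` ds_vertex.Y ` {1..b} \<or>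
    t = Inl ds_vertex.V \<and> s \<in> Inl ` ds_vertex.Y ` {1..b}"
  unfolding edges_double_star_K1 by (auto simp: doubleton_eq_iff image_iff)

lemma sum_double_star_K1:
  fixes t :: "ds_vertex + unit \<Rightarrow> real"
  shows "sum t (verts (double_star_K1 a b)) = (\<Sum>i=1..a. t (Inl (ds_vertex.X i))) +
    (\<Sum>j=1..b. t (Inl (ds_vertex.Y j))) + (t (Inl ds_vertex.U) + t (Inl ds_vertex.V) + t (Inr ()))"
proof -
  have "sum t (verts (double_star_K1 a b)) = sum t (Inl ` ds_vertex.X ` {1..a} \<union> Inl ` ds_vertex.Y ` {1..b}) +
      sum t {Inl ds_vertex.U, Inl ds_vertex.V, Inr ()}"
    unfolding verts_double_star_K1 by (intro sum.union_disjoint) auto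
  also have "sum t (Inl ` ds_vertex.X ` {1..a} \<union> Inl ` ds_vertex.Y ` {1..b}) =
      sum t (Inl ` ds_vertex.X ` {1..a}) + sum t (Inl ` ds_vertex.Y ` {1..b})"
    by (intro sum.union_disjoint) auto
  also have "sum t (Inl ` ds_vertex.X ` {1..a}) = (\<Sum>i=1..a. t (Inl (ds_vertex.X i)))"
    unfolding image_image by (subst sum.reindex) (auto simp: inj_on_def)
  also have "sum t (Inl ` ds_vertex.Y ` {1..b}) = (\<Sum>j=1..b. t (Inl (ds_vertex.Y j)))"
    unfolding image_image by (subst sum.reindex) (auto simp: inj_on_def)
  finally show ?thesis by (simp add: add.assoc)
qed

section \<open>The value of q when the complement is a double star with an isolated vertex\<close>

lemma q_graph_le_gram_isomorphic:
  fixes f g h :: "'b \<Rightarrow> real" and K :: "'b sgraph"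
  assumes G: "simple_graph G" "verts G = {..<n}" and iso: "graph_isomorphic (graph_complement G) K"
    and gram: "(\<Sum>s\<in>verts K. f s * f s) = \<alpha>" "(\<Sum>s\<in>verts K. g s * g s) = \<alpha>" "(\<Sum>s\<in>verts K. f s * g s) = \<delta>"
      "(\<Sum>s\<in>verts K. f s * h s) = 0" "(\<Sum>s\<in>verts K. g s * h s) = 0" "(\<Sum>s\<in>verts K. h s * h s) = \<gamma>"
    and pat: "\<And>s t. s \<in> verts K \<Longrightarrow> t \<in> verts K \<Longrightarrow> s \<noteq> t \<Longrightarrow>
      f s * f t + g s * g t + h s * h t = 0 \<longleftrightarrow> {s, t} \<in> edges K"
  shows "q_graph G \<le> card {0, \<alpha> + \<delta>, \<alpha> - \<delta>, \<gamma>}"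
proof -
  obtain \<phi> where bij: "bij_betw \<phi> {..<n} (verts K)"
    and adj: "\<And>i j. i < n \<Longrightarrow> j < n \<Longrightarrow> {i, j} \<in> edges (graph_complement G) \<longleftrightarrow> {\<phi> i, \<phi> j} \<in> edges K"
    using iso G(2) by (auto simp: graph_isomorphic_def graph_complement_def)
  have sum: "(\<Sum>i<n. t (\<phi> i)) = sum t (verts K)" for t :: "'b \<Rightarrow> real"
    by (rule sum.reindex_bij_betw[OF bij])
  show ?thesis
  proof (rule q_graph_le_gram[OF G, of "f \<circ> \<phi>" _ "g \<circ> \<phi>" _ "h \<circ> \<phi>"])
    fix i j assume "i < n" "j < n" "i \<noteq> j"
    moreover from this have "\<phi> i \<noteq> \<phi> j" "\<phi> i \<in> verts K" "\<phi> j \<in> verts K"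
      using bij by (auto simp: bij_betw_def inj_on_def)
    ultimately show "(f \<circ> \<phi>) i * (f \<circ> \<phi>) j + (g \<circ> \<phi>) i * (g \<circ> \<phi>) j + (h \<circ> \<phi>) i * (h \<circ> \<phi>) j = 0 \<longleftrightarrow>
        {i, j} \<in> edges (graph_complement G)"
      using adj pat by simp
  qed (use gram in \<open>simp_all add: sum[of "\<lambda>s. _ s * _ s"]\<close>)
qed

text \<open>The arguments are the values at the leaves of \<open>u\<close>, the leaves of \<open>v\<close>, \<open>u\<close>, \<open>v\<close> and the isolated vertex.\<close>

definition ds_labelling :: "'c \<Rightarrow> 'c \<Rightarrow> 'c \<Rightarrow> 'c \<Rightarrow> 'c \<Rightarrow> ds_vertex + unit \<Rightarrow> 'c" where
  "ds_labelling x y u v w = case_sum (case_ds_vertex (\<lambda>_. x) (\<lambda>_. y) u v) (\<lambda>_. w)"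

lemma ds_labelling_simps [simp]:
  "ds_labelling x y u v w (Inl (ds_vertex.X i)) = x"
  "ds_labelling x y u v w (Inl (ds_vertex.Y i)) = y"
  "ds_labelling x y u v w (Inl ds_vertex.U) = u"
  "ds_labelling x y u v w (Inl ds_vertex.V) = v"
  "ds_labelling x y u v w (Inr z) = w"
  by (simp_all add: ds_labelling_def)

text \<open>The model graph is represented by vectors, in three-space if both centres have leaves.
  If a centre has none, the graph is a star with an isolated vertex, and the plane suffices.\<close>

lemma double_star_q_le_3:
  assumes G: "simple_graph G" "verts G = {..<n}"
    and iso: "graph_isomorphic (graph_complement G) (double_star_K1 a b)"
  shows "q_graph G \<le> 3"
proof -
  consider "a \<ge> 1" "b \<ge> 1" | "b = 0" | "a = 0" by linarith
  then show ?thesis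
  proof cases
    case 1
    define p c where "p = - 1 / (2 * real a)" and "c = - 1 / (2 * real b)"
    have p: "real a * p = - 1 / 2" "p < 0" "p + 2 > 0" and c: "real b * c = - 1 / 2" "c < 0" "c + 2 > 0"
      using 1 by (auto simp: p_def c_def field_simps)
    \<comment> \<open>This keeps the radicands in \<open>s\<close> and \<open>t\<close>
      positive.\<close>
    have small: "real a * (p * p) < 1" "real b * (c * c) < 1"
    proof -
      have "real a * (p * p) = - p / 2" "real b * (c * c) = - c / 2"
        using p(1) c(1) by (simp_all add: mult.assoc[symmetric])
      then show "real a * (p * p) < 1" "real b * (c * c) < 1" using p(3) c(3) by simp_all
    qed
    define s t where "s = sqrt (4 * real a + 4 * real b - 1 - real b * (c * c))"
      and "t = sqrt (4 * real a + 4 * real b - 1 - real a * (p * p))"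
    have ab: "real a \<ge> 1" "real b \<ge> 1" using 1 by simp_all
    have s: "s * s = 4 * real a + 4 * real b - 1 - real b * (c * c)" "s > 0"
      and t: "t * t = 4 * real a + 4 * real b - 1 - real a * (p * p)" "t > 0"
      using small ab by (simp_all add: s_def t_def)
    \<comment> \<open>\<open>p\<close> and \<open>c\<close> make the third coordinate vector orthogonal to the other two, and \<open>s\<close> and \<open>t\<close> turn its
      squared norm into one of the two eigenvalues of the remaining block.\<close>
    let ?f = "ds_labelling 0 c s 0 1" and ?g = "ds_labelling p 0 0 t 1" and ?h = "ds_labelling 2 2 0 0 (1::real)"
    have "q_graph G \<le> card {0, (4 * real a + 4 * real b) + 1, (4 * real a + 4 * real b) - 1, 4 * real a + 4 * real b + 1}"
    proof (rule q_graph_le_gram_isomorphic[OF G iso, of ?f _ ?g _ ?h])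
      fix x y assume xy: "x \<in> verts (double_star_K1 a b)" "y \<in> verts (double_star_K1 a b)" "x \<noteq> y"
      have "p * p + 4 > 0" "c * c + 4 > 0" by (simp_all add: add_nonneg_pos)
      then show "?f x * ?f y + ?g x * ?g y + ?h x * ?h y = 0 \<longleftrightarrow> {x, y} \<in> edges (double_star_K1 a b)"
        using xy p(2,3) c(2,3) s(2) t(2)
        unfolding adjacent_double_star_K1 verts_double_star_K1
        by (elim UnE imageE insertE emptyE) (auto simp: algebra_simps)
    qed (use s t p(1) c(1) in \<open>simp_all add: sum_double_star_K1 algebra_simps\<close>)
    also have "\<dots> \<le> 3" by (simp add: card_insert_if)
    finally show ?thesis .
  next
    case 2
    \<comment> \<open>Here \<open>v\<close> is one more leaf of \<open>u\<close>. The
      \<open>a + 1\<close> leaf vectors \<open>(0, r)\<close> have total squared length 1, so both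
      coordinates get squared norm 2, with inner product 1 from the isolated vertex.\<close>
    define r where "r = 1 / sqrt (real a + 1)"
    have r: "r > 0" "real a * (r * r) + r * r = 1" by (auto simp: r_def field_simps)
    let ?f = "ds_labelling 0 0 1 0 1" and ?g = "ds_labelling r 0 0 r 1" and ?h = "\<lambda>_. 0 :: real"
    have "q_graph G \<le> card {0, 2 + 1, 2 - 1, 0 :: real}"
    proof (rule q_graph_le_gram_isomorphic[OF G iso, of ?f _ ?g _ ?h])
      fix x y assume xy: "x \<in> verts (double_star_K1 a b)" "y \<in> verts (double_star_K1 a b)" "x \<noteq> y"
      then show "?f x * ?f y + ?g x * ?g y + ?h x * ?h y = 0 \<longleftrightarrow> {x, y} \<in> edges (double_star_K1 a b)"
        using r(1) 2 unfolding adjacent_double_star_K1 verts_double_star_K1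
        by (elim UnE imageE insertE emptyE) auto
    qed (use r 2 in \<open>simp_all add: sum_double_star_K1 algebra_simps\<close>)
    also have "\<dots> \<le> 3" by (simp add: card_insert_if)
    finally show ?thesis .
  next
    case 3
    define r where "r = 1 / sqrt (real b + 1)"
    have r: "r > 0" "real b * (r * r) + r * r = 1" by (auto simp: r_def field_simps)
    let ?f = "ds_labelling 0 0 0 1 1" and ?g = "ds_labelling 0 r r 0 1" and ?h = "\<lambda>_. 0 :: real"
    have "q_graph G \<le> card {0, 2 + 1, 2 - 1, 0 :: real}"
    proof (rule q_graph_le_gram_isomorphic[OF G iso, of ?f _ ?g _ ?h])
      fix x y assume xy: "x \<in> verts (double_star_K1 a b)" "y \<in> verts (double_star_K1 a b)" "x \<noteq> y"
      then show "?f x * ?f y + ?g x * ?g y + ?h x * ?h y = 0 \<longleftrightarrow> {x, y} \<in> edges (double_star_K1 a b)"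
        using r(1) 3 unfolding adjacent_double_star_K1 verts_double_star_K1
        by (elim UnE imageE insertE emptyE) auto
    qed (use r 3 in \<open>simp_all add: sum_double_star_K1 algebra_simps\<close>)
    also have "\<dots> \<le> 3" by (simp add: card_insert_if)
    finally show ?thesis .
  qed
qed

text \<open>Every vertex besides the centres and the isolated vertex is a leaf at one centre, hence
  not adjacent to that centre in \<open>G\<close>. So the isolated vertex is the only common
  neighbour of the centres.\<close>

lemma double_star_q_ge_3:
  assumes G: "simple_graph G" "verts G = {..<n}"
    and iso: "graph_isomorphic (graph_complement G) (double_star_K1 a b)"
  shows "q_graph G \<ge> 3"
proof -
  let ?K = "double_star_K1 a b"
  obtain \<phi> where bij: "bij_betw \<phi> {..<n} (verts ?K)"
    and adj: "\<And>i j. i < n \<Longrightarrow> j < n \<Longrightarrow> {i, j} \<in> edges (graph_complement G) \<longleftrightarrow> {\<phi> i, \<phi> j} \<in> edges ?K"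
    using iso G(2) by (auto simp: graph_isomorphic_def graph_complement_def)
  have surj: "\<exists>i<n. \<phi> i = s" if "s \<in> verts ?K" for s
  proof -
    have "s \<in> \<phi> ` {..<n}" using bij that by (simp add: bij_betw_def)
    then show ?thesis by auto
  qed
  obtain u v w where uvw: "u < n" "v < n" "w < n"
    and \<phi>: "\<phi> u = Inl ds_vertex.U" "\<phi> v = Inl ds_vertex.V" "\<phi> w = Inr ()"
    using surj[of "Inl ds_vertex.U"] surj[of "Inl ds_vertex.V"] surj[of "Inr ()"]
    unfolding verts_double_star_K1 by auto
  have dist: "distinct [u, v, w]" using \<phi> by auto
  have edge: "{i, j} \<in> edges G \<longleftrightarrow> {\<phi> i, \<phi> j} \<notin> edges ?K" if "i < n" "j < n" "i \<noteq> j" for i j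
    using edges_graph_complement[OF G that] adj[OF that(1,2)] by simp
  obtain A where A: "A \<in> sym_matrices G" "q_mat A = q_graph G" using q_graph_attained[OF G(2)] by blast
  have "q_mat A \<ge> 3"
  proof (rule q_mat_ge_3[OF A(1) G(2) uvw dist])
    show "{u, v} \<notin> edges G" "{u, w} \<in> edges G" "{w, v} \<in> edges G"
      using uvw dist \<phi> by (auto simp: edge adjacent_double_star_K1)
    fix l assume l: "l < n" "l \<notin> {u, v, w}" "{u, l} \<in> edges G" "{l, v} \<in> edges G"
    have "\<phi> l \<in> verts ?K" "\<phi> l \<notin> {\<phi> u, \<phi> v, \<phi> w}"
      using bij l(1,2) uvw by (auto simp: bij_betw_def inj_on_def)
    then have "\<phi> l \<in> Inl ` ds_vertex.X ` {1..a} \<or> \<phi> l \<in> Inl ` ds_vertex.Y ` {1..b}"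
      unfolding verts_double_star_K1 \<phi> by blast
    moreover have "{\<phi> u, \<phi> l} \<notin> edges ?K" "{\<phi> l, \<phi> v} \<notin> edges ?K"
      using l uvw edge[of u l] edge[of l v] by auto
    ultimately show False by (elim disjE) (simp_all add: \<phi> adjacent_double_star_K1)
  qed
  then show ?thesis using A(2) by simp
qed

section \<open>Recognising double stars\<close>

lemma isomorphic_double_star_K1:
  fixes H :: "'a sgraph"
  assumes fin: "finite P" "finite Q" and V: "verts H = insert w (P \<union> Q)" and w: "w \<notin> P" "w \<notin> Q"
    and disj: "P \<inter> Q = {}" and x: "x \<in> P" and y: "y \<in> Q"
    and E: "edges H = (\<lambda>(p, q). {p, q}) ` ({x} \<times> Q \<union> P \<times> {y})"
  shows "\<exists>a b. graph_isomorphic H (double_star_K1 a b)"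
proof -
  \<comment> \<open>The sides cross over: the leaves at \<open>x\<close>, which lies in
    \<open>P\<close>, are in \<open>Q\<close>, and those at \<open>y\<close> are in
    \<open>P\<close>.\<close>
  define a b where "a = card (Q - {y})" and "b = card (P - {x})"
  obtain h where h: "bij_betw h (Q - {y}) {1..a}"
    using ex_bij_betw_nat_finite_1[of "Q - {y}"] fin bij_betw_inv unfolding a_def by blast
  obtain k where k: "bij_betw k (P - {x}) {1..b}"
    using ex_bij_betw_nat_finite_1[of "P - {x}"] fin bij_betw_inv unfolding b_def by blast
  define \<phi> where "\<phi> = (\<lambda>v. if v = w then Inr () else Inl (if v = x then ds_vertex.U else if v = y then ds_vertex.V
    else if v \<in> P then ds_vertex.Y (k v) else ds_vertex.X (h v)))"
  have ne: "x \<noteq> w" "y \<noteq> w" "x \<noteq> y" "x \<notin> Q" "y \<notin> P" using x y w disj by auto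
  have \<phi>: "\<phi> w = Inr ()" "\<phi> x = Inl ds_vertex.U" "\<phi> y = Inl ds_vertex.V"
    "v \<in> P - {x} \<Longrightarrow> \<phi> v = Inl (ds_vertex.Y (k v))" "v \<in> Q - {y} \<Longrightarrow> \<phi> v = Inl (ds_vertex.X (h v))" for v
    using ne w disj by (auto simp: \<phi>_def)
  have cases: "v = w \<and> v \<notin> P \<and> v \<notin> Q \<or> v = x \<and> v \<in> P \<and> v \<notin> Q \<or> v = y \<and> v \<in> Q \<and> v \<notin> P \<or>
      v \<in> P - {x} \<and> v \<in> P \<and> v \<notin> Q \<or> v \<in> Q - {y} \<and> v \<in> Q \<and> v \<notin> P"
    if "v \<in> verts H" for v
    using that w x y disj unfolding V by blast
  have img: "\<phi> ` (P - {x}) = Inl ` ds_vertex.Y ` {1..b}" "\<phi> ` (Q - {y}) = Inl ` ds_vertex.X ` {1..a}"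
    using bij_betw_imp_surj_on[OF h] bij_betw_imp_surj_on[OF k] \<phi>(4,5)
    by (auto simp: image_image intro!: image_cong)
  have "\<phi> ` verts H = verts (double_star_K1 a b)"
  proof -
    have "verts H = (Q - {y}) \<union> (P - {x}) \<union> {x, y, w}" using V x y by auto
    then show ?thesis unfolding verts_double_star_K1 by (simp add: image_Un img \<phi>(1-3))
  qed
  moreover have "inj_on \<phi> (verts H)"
  proof (rule inj_onI)
    fix u v assume uv: "u \<in> verts H" "v \<in> verts H" "\<phi> u = \<phi> v"
    show "u = v"
      using uv(3) cases[OF uv(1)] cases[OF uv(2)] \<phi> inj_onD[OF bij_betw_imp_inj_on[OF h], of u v]
        inj_onD[OF bij_betw_imp_inj_on[OF k], of u v]
      by (elim disjE conjE) simp_all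
  qed
  ultimately have bij: "bij_betw \<phi> (verts H) (verts (double_star_K1 a b))" by (simp add: bij_betw_def)
  have "{u, v} \<in> edges H \<longleftrightarrow> {\<phi> u, \<phi> v} \<in> edges (double_star_K1 a b)"
    if uv: "u \<in> verts H" "v \<in> verts H" for u v
  proof -
    have "{u, v} \<in> (\<lambda>(p, q). {p, q}) ` T \<longleftrightarrow> (u, v) \<in> T \<or> (v, u) \<in> T" for T :: "('a \<times> 'a) set"
      by (force simp: doubleton_eq_iff)
    then have edge: "{u, v} \<in> edges H \<longleftrightarrow> u = x \<and> v \<in> Q \<or> u \<in> P \<and> v = y \<or> v = x \<and> u \<in> Q \<or> v \<in> P \<and> u = y"
      unfolding E by simp
    have \<phi>_iff: "\<phi> t \<in> Inl ` ds_vertex.X ` {1..a} \<longleftrightarrow> t \<in> Q - {y}" "\<phi> t \<in> Inl ` ds_vertex.Y ` {1..b} \<longleftrightarrow> t \<in> P - {x}"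
      "\<phi> t = Inl ds_vertex.U \<longleftrightarrow> t = x" "\<phi> t = Inl ds_vertex.V \<longleftrightarrow> t = y" if "t \<in> verts H" for t
      unfolding img[symmetric] using cases[OF that] ne \<phi> by (elim disjE conjE; force)+
    show ?thesis
      unfolding edge adjacent_double_star_K1 \<phi>_iff[OF uv(1)] \<phi>_iff[OF uv(2)] using x y by blast
  qed
  with bij show ?thesis unfolding graph_isomorphic_def by blast
qed

text \<open>With \<open>w\<close> placed on either side, \<Gamma> must be disconnected. This gives
  \<open>x\<close> and \<open>y\<close> on opposite sides, each joined in the complement to
  everything opposite except \<open>w\<close>. Their edges form a double star on the
  \<open>n - 1\<close> other vertices, a tree with \<open>n - 2\<close> edges, which leaves no
  further edge.\<close>

lemma isolated_vertex_cases:
  assumes G: "simple_graph G" "verts G = {..<n}" and n: "n \<ge> 3"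
    and bip: "bipartition (edges (graph_complement G)) {..<n} P Q"
    and card_E: "card (edges (graph_complement G)) = n - 2"
    and w: "w < n" "\<And>e. e \<in> edges (graph_complement G) \<Longrightarrow> w \<notin> e"
    and not: "\<not> q_graph G \<le> 2"
  shows "\<exists>a b. graph_isomorphic (graph_complement G) (double_star_K1 a b)"
proof -
  define E where "E = edges (graph_complement G)"
  define P' Q' where "P' = P - {w}" and "Q' = Q - {w}"
  have PQ: "P \<union> Q = {..<n}" "P \<inter> Q = {}" using bip by (auto simp: bipartition_def)
  have PQ': "insert w (P' \<union> Q') = {..<n}" "P' \<inter> Q' = {}" "w \<notin> P'" "w \<notin> Q'"
    using PQ w(1) by (auto simp: P'_def Q'_def)
  have fin_E: "finite E" using G(2) by (auto simp: E_def graph_complement_def all_pairs_def)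
  have fin: "finite P'" "finite Q'" using PQ'(1) by (auto intro: finite_subset[of _ "{..<n}"])
  have edge: "\<exists>p\<in>P'. \<exists>q\<in>Q'. e = {p, q}" if "e \<in> E" for e
  proof -
    obtain p q where "p \<in> P" "q \<in> Q" "e = {p, q}"
      by (rule bipartition_edgeE[OF bip \<open>e \<in> E\<close>[unfolded E_def]])
    moreover from this(3) have "p \<noteq> w" "q \<noteq> w" using w(2)[of e] that by (auto simp: E_def)
    ultimately show ?thesis by (auto simp: P'_def Q'_def)
  qed
  have "\<exists>p\<in>insert w P'. \<exists>q\<in>Q'. e = {p, q}" "\<exists>p\<in>P'. \<exists>q\<in>insert w Q'. e = {p, q}" if "e \<in> E" for e
    using edge[OF that] by (meson insertI2)+
  then have "bipartition E {..<n} (insert w P') Q'" and "bipartition E {..<n} P' (insert w Q')"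
    unfolding bipartition_def using PQ' by (intro conjI ballI; auto)+
  then have bip1: "bipartition E {..<n} (insert w P') Q'" and bip2: "bipartition E {..<n} (insert w Q') P'"
    by (auto intro: bipartition_swap)
  have "E \<noteq> {}" using card_E n unfolding E_def by force
  then obtain e where "e \<in> E" by blast
  then have ne: "P' \<noteq> {}" "Q' \<noteq> {}" using edge[of e] by auto
  \<comment> \<open>The vertex \<open>s\<close> cannot be \<open>w\<close>, since \<open>w\<close>
    is isolated and \<open>T\<close> is nonempty. Both placements of \<open>w\<close> are
    instances.\<close>
  have full: "\<exists>s\<in>S. \<forall>t\<in>T. {s, t} \<in> E" if "bipartition E {..<n} (insert w S) T" "T \<noteq> {}" for S T
  proof (rule ccontr)
    assume no: "\<not> (\<exists>s\<in>S. \<forall>t\<in>T. {s, t} \<in> E)"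
    have "\<exists>t\<in>T. {s, t} \<notin> E" if "s \<in> insert w S" for s
    proof (cases "s = w")
      case True
      then show ?thesis using w(2) \<open>T \<noteq> {}\<close> unfolding E_def by blast
    next
      case False
      then show ?thesis using no that by blast
    qed
    then have "q_graph G \<le> 2"
      using isolated_vertex_connected[OF G, of "insert w S" T w] that(1) w(2) unfolding E_def by blast
    with not show False by simp
  qed
  obtain x where x: "x \<in> P'" "\<And>q. q \<in> Q' \<Longrightarrow> {x, q} \<in> E" using full[OF bip1 ne(2)] by blast
  obtain y where y: "y \<in> Q'" "\<And>p. p \<in> P' \<Longrightarrow> {y, p} \<in> E" using full[OF bip2 ne(1)] by blast
  define S where "S = {x} \<times> Q' \<union> P' \<times> {y}"
  \<comment> \<open>Removing \<open>x\<close> from the second product avoids counting the edge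
    between the centres twice.\<close>
  have "card S = card ({x} \<times> Q') + card ((P' - {x}) \<times> {y})"
  proof -
    have "S = {x} \<times> Q' \<union> (P' - {x}) \<times> {y}" using y(1) by (auto simp: S_def)
    then show ?thesis using fin by (simp only:) (intro card_Un_disjoint; auto)
  qed
  also have "\<dots> = card Q' + (card P' - 1)" using x(1) fin by (simp add: card_cartesian_product)
  finally have "card S = card Q' + (card P' - 1)" .
  moreover have "n = Suc (card P' + card Q')"
  proof -
    have "n = card (insert w (P' \<union> Q'))" unfolding PQ'(1) by simp
    then show ?thesis using PQ'(2-4) fin by (simp add: card_Un_disjoint)
  qed
  moreover have "card P' \<ge> 1" using ne(1) fin(1) by (simp add: Suc_le_eq card_gt_0_iff)
  ultimately have "card E \<le> card S" using card_E unfolding E_def by simp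
  then have "E = (\<lambda>(p, q). {p, q}) ` S"
    using x y by (intro card_edges_ge(2)[OF fin_E PQ'(2)]) (auto simp: S_def insert_commute[of _ y])
  then show ?thesis
    using isomorphic_double_star_K1[OF fin, of "graph_complement G" w x y] PQ' x(1) y(1) G(2)
    unfolding E_def S_def by (simp add: graph_complement_def)
qed

section \<open>The dichotomy between q = 2 and q = 3\<close>

theorem theorem4p1:
  fixes G :: "nat sgraph" and n :: nat
  assumes "simple_graph G"
    and "verts G = {..<n}"
    and "n \<ge> 3"
    and "bipartite (graph_complement G)"
    and "card (edges (graph_complement G)) = n - 2"
  shows "(q_graph G = 3 \<longleftrightarrow>
            (\<exists>a b. graph_isomorphic (graph_complement G) (disjoint_union (double_star a b) K1)))
       \<and> (\<not> (\<exists>a b. graph_isomorphic (graph_complement G) (disjoint_union (double_star a b) K1))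
            \<longrightarrow> q_graph G = 2)"
proof (cases "\<exists>a b. graph_isomorphic (graph_complement G) (double_star_K1 a b)")
  case True
  then have "q_graph G = 3"
    using double_star_q_le_3[OF assms(1,2)] double_star_q_ge_3[OF assms(1,2)] order_antisym by blast
  with True show ?thesis by simp
next
  case False
  obtain P Q where bip: "bipartition (edges (graph_complement G)) {..<n} P Q"
    using assms(2,4) unfolding bipartite_def bipartition_def by (auto simp: graph_complement_def)
  have PQ: "P \<union> Q = {..<n}" "P \<inter> Q = {}" using bip by (auto simp: bipartition_def)
  have "q_graph G \<le> 2"
  proof (cases "\<exists>w<n. \<forall>e\<in>edges (graph_complement G). w \<notin> e")
    case True
    then show ?thesis using isolated_vertex_cases[OF assms(1-3) bip assms(5)] False by blast
  next
    case no_iso: False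
    then show ?thesis using no_isolated_vertex_q_le_2[OF assms(1,2) bip assms(5,3)] by blast
  qed
  moreover have "q_graph G \<ge> 2"
  proof -
    obtain i j where ij: "i < n" "j < n" "i \<noteq> j" "(i \<in> P) = (j \<in> P)"
    proof -
      \<comment> \<open>Two of any three vertices lie in the same part and are therefore adjacent in
        \<open>G\<close>, which rules out a single eigenvalue.\<close>
      have "(0 \<in> P) = (1 \<in> P) \<or> (0 \<in> P) = (2 \<in> P) \<or> (1 \<in> P) = (2 \<in> P)" by blast
      then show thesis using that[of 0 1] that[of 0 2] that[of 1 2] assms(3) by auto
    qed
    have "{i, j} \<notin> edges (graph_complement G)"
    proof
      assume "{i, j} \<in> edges (graph_complement G)"
      then obtain p q where "p \<in> P" "q \<in> Q" "{i, j} = {p, q}" by (rule bipartition_edgeE[OF bip])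
      then show False using ij(4) PQ(2) by (auto simp: doubleton_eq_iff)
    qed
    then have "{i, j} \<in> edges G" using edges_graph_complement[OF assms(1,2) ij(1-3)] by simp
    then show ?thesis using q_graph_attained[OF assms(2)] q_mat_ge_2[OF _ assms(2) ij(1-3)] by metis
  qed
  ultimately show ?thesis using False by simp
qed

end
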